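(* Let $\delta_k>0$ with $\delta_k\to0$ and let $g_k\in H_2$ with $\|g_k-g\|\le\delta_k$. Let $\Gamma$ be Morozov's discrepancy principle with parameter $\rho>1$ and assume that $\lim_{k\to\infty}\Gamma(\delta_k,g_k)=\infty$. Write $n_k=\Gamma(\delta_k,g_k)$, $u_k=\mathcal{R}_{n_k}(g_k)$ and $\xi_k=K^*\mathcal{R}^*_{n_k}(g_k)\in\partial J(u_k)$. Then the sequence $\{u_k\}_{k\in\mathbb{N}}$ is bounded and each weak cluster point $u^\dagger$ of it is a $J$-minimizing solution of $Ku=g$. Additionally, $$\lim_{k\to\infty}J(u_k)=J(u^\dagger),\qquad\lim_{k\to\infty}D_J^{\xi_k}(u^\dagger,u_k)=0,$$ and $$\|Ku_k-g\|=\mathcal{O}\big(t_{n_k}^{-1/2}\big)\quad(k\to\infty).$$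
   Context: $H_1,H_2$ are separable (real) Hilbert spaces, $K:H_1\to H_2$ is linear and bounded with adjoint $K^*$, and $J:H_1\to\mathbb{R}\cup\{\infty\}$ is convex, lower semicontinuous and proper with domain $D(J)=\{u: J(u)<\infty\}$. It is assumed that for every $c\in\mathbb{R}$ every sequence in $\{u\in H_1:\|Ku\|^2+J(u)\le c\}$ has a weakly convergent subsequence in $H_1$. The element $g\in H_2$ is attainable, i.e. $Ku=g$ for some $u\in D(J)$. A $J$-minimizing solution of $Ku=g$ is a minimizer of $J(u)$ subject to $Ku=g$. Augmented Lagrangian method: $\{\tau_n\}_{n\ge1}$ is a fixed sequence of positive numbers, $t_n:=\sum_{k=1}^n\tau_k$, with $t_n\to+\infty$ and $\bar\tau:=\sup_k\tau_k<\infty$. Given data $g^\delta$ and a fixed starting element $p_0^\delta=p_0\in H_2$, for $n=1,2,\dots$ $$u_n^\delta\in\operatorname{argmin}_{u\in H_1}\Big(\tfrac{\tau_n}{2}\|Ku-g^\delta\|^2+J(u)-\langle p_{n-1}^\delta,Ku-g^\delta\rangle\Big),\qquad p_n^\delta=p_{n-1}^\delta+\tau_n(g^\delta-Ku_n^\delta).$$ Set $\mathcal{R}_n(g^\delta):=u_n^\delta$ and $\mathcal{R}_n^*(g^\delta):=p_n^\delta$; one has $K^*p_n^\delta\in\partial J(u_n^\delta)$. Morozov's discrepancy principle with $\rho>1$ is the stopping rule $\Gamma(\delta,g^\delta):=\min\{n\in\mathbb{N}, n\ge1:\ \|Ku_n^\delta-g^\delta\|<\rho\delta\}$ (this minimum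 exists whenever $\|g^\delta-g\|\le\delta$). For $\xi\in\partial J(u)$ the Bregman distance is $D_J^\xi(v,u)=J(v)-J(u)-\langle\xi,v-u\rangle$. *)

theory Defs
  imports "HOL-Analysis.Analysis" "HOL-Library.Landau_Symbols"
begin

section \<open>Extended-real-valued convex functionals\<close>

definition effective_domain :: "('a \<Rightarrow> ereal) \<Rightarrow> 'a set" where
  "effective_domain J = {u. J u < \<infinity>}"

text \<open>The first conjunct excludes the value \<open>-\<infinity>\<close>, which the type \<^typ>\<open>ereal\<close> would allow.\<close>

definition proper :: "('a \<Rightarrow> ereal) \<Rightarrow> bool" where
  "proper J \<longleftrightarrow> (\<forall>u. J u \<noteq> -\<infinity>) \<and> effective_domain J \<noteq> {}"

text \<open>The library's \<^const>\<open>convex_on\<close> covers real-valued functions only.\<close>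

definition econvex :: "('a::real_vector \<Rightarrow> ereal) \<Rightarrow> bool" where
  "econvex J \<longleftrightarrow> (\<forall>x y s. 0 < s \<and> s < 1 \<longrightarrow>
     J (s *\<^sub>R x + (1 - s) *\<^sub>R y) \<le> ereal s * J x + ereal (1 - s) * J y)"

definition lower_semicontinuous :: "('a::topological_space \<Rightarrow> ereal) \<Rightarrow> bool" where
  "lower_semicontinuous J \<longleftrightarrow> (\<forall>x. J x \<le> Liminf (at x) J)"

text \<open>For proper \<open>J\<close> the inequality forces \<open>J u < \<infinity>\<close>, so the subdifferential is empty
  outside the domain.\<close>

definition subdifferential :: "('a::real_inner \<Rightarrow> ereal) \<Rightarrow> 'a \<Rightarrow> 'a set" where
  "subdifferential J u = {\<xi>. \<forall>v. J u + ereal (\<xi> \<bullet> (v - u)) \<le> J v}"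

text \<open>Meaningful for \<open>\<xi> \<in> subdifferential J u\<close>, where \<open>J u\<close> is finite.\<close>

definition bregman_distance :: "('a::real_inner \<Rightarrow> ereal) \<Rightarrow> 'a \<Rightarrow> 'a \<Rightarrow> 'a \<Rightarrow> ereal" where
  "bregman_distance J \<xi> v u = J v - J u - ereal (\<xi> \<bullet> (v - u))"

definition J_minimizing_solution ::
    "('a \<Rightarrow> ereal) \<Rightarrow> ('a \<Rightarrow> 'b) \<Rightarrow> 'b \<Rightarrow> 'a \<Rightarrow> bool" where
  "J_minimizing_solution J K g u \<longleftrightarrow> is_arg_min J (\<lambda>v. K v = g) u"

section \<open>Weak convergence\<close>

definition weakly_converges :: "(nat \<Rightarrow> 'a::real_normed_vector) \<Rightarrow> 'a \<Rightarrow> bool" where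
  "weakly_converges x l \<longleftrightarrow>
     (\<forall>f :: 'a \<Rightarrow> real. bounded_linear f \<longrightarrow> (\<lambda>n. f (x n)) \<longlonglongrightarrow> f l)"

definition weak_cluster_point :: "(nat \<Rightarrow> 'a::real_normed_vector) \<Rightarrow> 'a \<Rightarrow> bool" where
  "weak_cluster_point x l \<longleftrightarrow> (\<exists>r. strict_mono r \<and> weakly_converges (x \<circ> r) l)"

definition weakly_compact_sublevels ::
    "('a::real_normed_vector \<Rightarrow> 'b::real_normed_vector) \<Rightarrow> ('a \<Rightarrow> ereal) \<Rightarrow> bool" where
  "weakly_compact_sublevels K J \<longleftrightarrow>
     (\<forall>(c::real) (x :: nat \<Rightarrow> 'a). (\<forall>n. ereal ((norm (K (x n)))\<^sup>2) + J (x n) \<le> ereal c) \<longrightarrow>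
        (\<exists>l r. strict_mono r \<and> weakly_converges (x \<circ> r) l))"

section \<open>The augmented Lagrangian method and Morozov's discrepancy principle\<close>

definition alm_objective ::
    "('a \<Rightarrow> 'b::real_inner) \<Rightarrow> ('a \<Rightarrow> ereal) \<Rightarrow> real \<Rightarrow> 'b \<Rightarrow> 'b \<Rightarrow> 'a \<Rightarrow> ereal" where
  "alm_objective K J s gd q u =
     ereal (s / 2 * (norm (K u - gd))\<^sup>2) + J u - ereal (q \<bullet> (K u - gd))"

text \<open>\<open>u n\<close> and \<open>p n\<close> are the primal and dual iterates for the data \<open>gd\<close>. The step sizes
  \<open>\<tau> n\<close> and the primal iterates are indexed from 1; \<open>\<tau> 0\<close> and \<open>u 0\<close> are never used.
  Since minimizers need not be unique, the iteration is a relation: \<open>u n\<close> is any minimizer.\<close>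

definition alm_iteration ::
    "('a \<Rightarrow> 'b::real_inner) \<Rightarrow> ('a \<Rightarrow> ereal) \<Rightarrow> (nat \<Rightarrow> real) \<Rightarrow> 'b \<Rightarrow> 'b \<Rightarrow>
     (nat \<Rightarrow> 'a) \<Rightarrow> (nat \<Rightarrow> 'b) \<Rightarrow> bool" where
  "alm_iteration K J \<tau> p0 gd u p \<longleftrightarrow>
     p 0 = p0 \<and>
     (\<forall>n\<ge>1. is_arg_min (alm_objective K J (\<tau> n) gd (p (n - 1))) (\<lambda>_. True) (u n) \<and>
            p n = p (n - 1) + \<tau> n *\<^sub>R (gd - K (u n)))"

definition alm_time :: "(nat \<Rightarrow> real) \<Rightarrow> nat \<Rightarrow> real" where
  "alm_time \<tau> n = (\<Sum>k=1..n. \<tau> k)"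

text \<open>\<open>R n gd\<close> is the \<open>n\<close>-th primal iterate for the data \<open>gd\<close>. If \<open>\<rho> > 1\<close> and
  the noise level \<open>\<delta> > 0\<close> bounds the data error, an admissible index exists, so \<open>LEAST\<close> is the minimum.\<close>

definition morozov ::
    "('a \<Rightarrow> 'b::real_normed_vector) \<Rightarrow> (nat \<Rightarrow> 'b \<Rightarrow> 'a) \<Rightarrow> real \<Rightarrow> real \<Rightarrow> 'b \<Rightarrow> nat" where
  "morozov K R \<rho> \<delta> gd = (LEAST n. 1 \<le> n \<and> norm (K (R n gd) - gd) < \<rho> * \<delta>)"

end

theory Submission
  imports Defs
begin

text \<open>
  Let \<open>r\<^sub>n = f - K u\<^sub>n\<close> be the residual for data \<open>f\<close> and
  \<open>D\<^sub>n v = J v - J u\<^sub>n - \<langle>p\<^sub>n, K (v - u\<^sub>n)\<rangle>\<close> the Bregman distance. If \<open>K v = g\<close>, each step lowers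
  \<open>D\<^sub>n v\<close> by at least \<open>\<tau>\<^sub>n (\<parallel>r\<^sub>n\<parallel>\<^sup>2 - \<parallel>f - g\<parallel> \<parallel>r\<^sub>n\<parallel>)\<close>, which is positive as long as the
  discrepancy principle is not met.

  For exact data this makes \<open>\<Sum> \<tau>\<^sub>n \<parallel>r\<^sub>n\<parallel>\<^sup>2\<close> finite. As \<open>\<parallel>r\<^sub>n\<parallel>\<close> is decreasing,
  \<open>\<parallel>r\<^sub>n\<parallel> = O(t\<^sub>n\<^sup>-\<^sup>1\<^sup>/\<^sup>2)\<close>, while \<open>\<parallel>p\<^sub>n\<parallel> = o(t\<^sub>n\<^sup>1\<^sup>/\<^sup>2)\<close> by Cauchy-Schwarz, so \<open>\<langle>p\<^sub>n, r\<^sub>n\<rangle> \<rightarrow> 0\<close>.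
  By weak compactness there is a minimizing solution \<open>w\<close>, and \<open>D\<^sub>n w\<close> tends to 0.

  For noisy data, \<open>p\<^sub>m\<close> depends continuously on the data for fixed \<open>m\<close>, hence \<open>D\<^sub>m w\<close> is small for
  some fixed \<open>m\<close> and all small noise levels. Summing the descent from \<open>m\<close> to the stopping index
  \<open>n\<close> shows that \<open>D\<^sub>n w\<close>, \<open>\<delta>\<^sup>2 t\<^sub>n\<close> and \<open>\<delta> \<parallel>p\<^sub>n\<parallel>\<close> all become small, and these three quantities
  give every claim.
\<close>

section \<open>Weak topology of a Hilbert space\<close>

text \<open>A sequence minimizing the distance to \<open>l\<close> is Cauchy by the parallelogram
  law, and its limit \<open>a\<close> is a nearest point. If \<open>l - a\<close> had a positive
  inner product with some \<open>y - a\<close>, a small move from \<open>a\<close> towards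
  \<open>y\<close> would come closer to \<open>l\<close>.\<close>

lemma closest_point_Hilbert:
  fixes S :: "'a::{real_inner, complete_space} set"
  assumes "convex S" "closed S" "S \<noteq> {}"
  obtains a where "a \<in> S" "\<And>y. y \<in> S \<Longrightarrow> (l - a) \<bullet> (y - a) \<le> 0"
proof -
  define d where "d = Inf ((\<lambda>y. (norm (l - y))\<^sup>2) ` S)"
  have bdd: "bdd_below ((\<lambda>y. (norm (l - y))\<^sup>2) ` S)"
    by (rule bdd_belowI2[of _ 0]) simp
  have d_le: "d \<le> (norm (l - y))\<^sup>2" if "y \<in> S" for y
    unfolding d_def using that bdd by (intro cInf_lower) auto
  have "\<exists>y\<in>S. (norm (l - y))\<^sup>2 < d + inverse (real (Suc n))" for n
  proof -
    have "\<exists>z\<in>(\<lambda>y. (norm (l - y))\<^sup>2) ` S. z < d + inverse (real (Suc n))"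
      unfolding d_def using assms(3) by (intro cInf_lessD) auto
    then show ?thesis by auto
  qed
  then obtain y where y: "\<And>n. y n \<in> S" "\<And>n. (norm (l - y n))\<^sup>2 < d + inverse (real (Suc n))"
    by metis
  \<comment> \<open>Parallelogram law: the midpoint of \<open>x\<close> and \<open>z\<close> lies in
    \<open>S\<close>, so its squared distance to \<open>l\<close> is at least
    \<open>d\<close>.\<close>
  have par: "(norm (x - z))\<^sup>2 \<le> 2 * ((norm (l - x))\<^sup>2 - d) + 2 * ((norm (l - z))\<^sup>2 - d)"
    if "x \<in> S" "z \<in> S" for x z
  proof -
    have "(1/2) *\<^sub>R x + (1/2) *\<^sub>R z \<in> S"
      by (intro convexD[OF assms(1) that]) auto
    then have "d \<le> (norm (l - ((1/2) *\<^sub>R x + (1/2) *\<^sub>R z)))\<^sup>2" by (rule d_le)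
    moreover have "(norm (x - z))\<^sup>2 = 2 * (norm (l - x))\<^sup>2 + 2 * (norm (l - z))\<^sup>2
        - 4 * (norm (l - ((1/2) *\<^sub>R x + (1/2) *\<^sub>R z)))\<^sup>2"
      unfolding power2_norm_eq_inner by (simp add: inner_simps inner_commute field_simps)
    ultimately show ?thesis by simp
  qed
  have "Cauchy y"
  proof (rule metric_CauchyI)
    fix e :: real assume "e > 0"
    then obtain N where N: "inverse (real (Suc N)) < e\<^sup>2 / 4"
      using reals_Archimedean[of "e\<^sup>2/4"] by auto
    have "dist (y m) (y n) < e" if "m \<ge> N" "n \<ge> N" for m n
    proof -
      have "(norm (l - y k))\<^sup>2 - d < e\<^sup>2 / 4" if "k \<ge> N" for k
      proof -
        have "(norm (l - y k))\<^sup>2 - d < inverse (real (Suc k))" using y(2)[of k] by linarith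
        also have "\<dots> \<le> inverse (real (Suc N))" using that by (simp add: field_simps)
        finally show ?thesis using N by (rule less_trans)
      qed
      note close = this[OF that(1)] this[OF that(2)]
      have "(norm (y m - y n))\<^sup>2 \<le> 2 * ((norm (l - y m))\<^sup>2 - d) + 2 * ((norm (l - y n))\<^sup>2 - d)"
        by (intro par y)
      also have "\<dots> < 2 * (e\<^sup>2 / 4) + 2 * (e\<^sup>2 / 4)"
        using close by (intro add_strict_mono mult_strict_left_mono) auto
      finally have "(norm (y m - y n))\<^sup>2 < e\<^sup>2" by simp
      then show ?thesis
        using \<open>e > 0\<close> by (simp add: dist_norm power_less_imp_less_base)
    qed
    then show "\<exists>M. \<forall>m\<ge>M. \<forall>n\<ge>M. dist (y m) (y n) < e" by blast
  qed
  then obtain a where a: "y \<longlonglongrightarrow> a" using Cauchy_convergent convergentD by blast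
  have aS: "a \<in> S" using closed_sequentially[OF assms(2)] y(1) a by blast
  have "(norm (l - a))\<^sup>2 \<le> d"
  proof (rule LIMSEQ_le)
    show "(\<lambda>n. (norm (l - y n))\<^sup>2) \<longlonglongrightarrow> (norm (l - a))\<^sup>2" by (intro tendsto_intros a)
    show "(\<lambda>n. d + inverse (real (Suc n))) \<longlonglongrightarrow> d"
      using tendsto_add[OF tendsto_const LIMSEQ_inverse_real_of_nat] by simp
  qed (use y(2) in \<open>auto intro: less_imp_le\<close>)
  then have min: "(norm (l - a))\<^sup>2 \<le> (norm (l - y))\<^sup>2" if "y \<in> S" for y
    using d_le[OF that] by linarith
  have "(l - a) \<bullet> (y - a) \<le> 0" if "y \<in> S" for y
  proof (rule ccontr)
    define c where "c = (l - a) \<bullet> (y - a)"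
    define q where "q = (norm (y - a))\<^sup>2"
    assume "\<not> (l - a) \<bullet> (y - a) \<le> 0"
    then have c: "c > 0" by (simp add: c_def)
    then have "y \<noteq> a" by (auto simp: c_def)
    then have q: "q > 0" by (simp add: q_def)
    \<comment> \<open>The cap 1 keeps the new point on the segment from \<open>a\<close> to
      \<open>y\<close>; the cap \<open>c / q\<close> makes the quadratic term at most half of the
      linear gain \<open>2 * s * c\<close>.\<close>
    define s where "s = min 1 (c / q)"
    have s: "0 < s" "s \<le> 1" "s * q \<le> c" using c q by (auto simp: s_def min_def field_simps)
    have "(1 - s) *\<^sub>R a + s *\<^sub>R y \<in> S"
      using convexD[OF assms(1) aS that, of "1 - s" s] s by simp
    then have "(norm (l - a))\<^sup>2 \<le> (norm (l - ((1 - s) *\<^sub>R a + s *\<^sub>R y)))\<^sup>2" by (rule min)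
    also have "l - ((1 - s) *\<^sub>R a + s *\<^sub>R y) = (l - a) - s *\<^sub>R (y - a)"
      by (simp add: algebra_simps)
    also have "(norm \<dots>)\<^sup>2 = (norm (l - a))\<^sup>2 - 2 * s * c + s * (s * q)"
      unfolding power2_norm_eq_inner c_def q_def
      by (simp add: inner_diff_left inner_diff_right inner_commute algebra_simps)
    finally have "2 * (s * c) \<le> s * (s * q)" by simp
    also have "\<dots> \<le> s * c" using s by (intro mult_left_mono) auto
    finally show False using s c by (simp add: mult_le_0_iff)
  qed
  with aS that show thesis by blast
qed

text \<open>The point of least norm on the hyperplane \<open>f = 1\<close> is orthogonal to the
  kernel of \<open>f\<close>, so a multiple of it represents \<open>f\<close>.\<close>

lemma Riesz_representation:
  fixes f :: "'a::{real_inner, complete_space} \<Rightarrow> real"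
  assumes "bounded_linear f"
  obtains w where "\<And>x. f x = x \<bullet> w"
proof (cases "\<forall>x. f x = 0")
  case True
  then show thesis using that[of 0] by simp
next
  interpret bounded_linear f by fact
  case False
  then obtain z where z: "f z \<noteq> 0" by blast
  define S where "S = f -` {1}"
  have "f (z /\<^sub>R f z) = 1" using z by (simp add: scaleR)
  then have "S \<noteq> {}" unfolding S_def by blast
  moreover have "closed S" unfolding S_def
    by (intro closed_vimage closed_singleton linear_continuous_on assms) 
  moreover have "convex S" unfolding S_def
    by (auto simp: convex_def add scaleR)
  ultimately obtain a where a: "a \<in> S" "\<And>y. y \<in> S \<Longrightarrow> (0 - a) \<bullet> (y - a) \<le> 0"
    using closest_point_Hilbert[of S 0] by blast
  have fa: "f a = 1" using a by (simp add: S_def)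
  then have "a \<noteq> 0" by (auto simp: zero)
  have orth: "a \<bullet> h = 0" if "f h = 0" for h
  proof -
    have "a + h \<in> S" "a - h \<in> S" using that fa by (auto simp: S_def add diff)
    from a(2)[OF this(1)] a(2)[OF this(2)] show ?thesis by simp
  qed
  have "f x = x \<bullet> (a /\<^sub>R (a \<bullet> a))" for x
  proof -
    have "a \<bullet> (x - f x *\<^sub>R a) = 0" by (rule orth) (simp add: diff scaleR fa)
    then show ?thesis using \<open>a \<noteq> 0\<close> by (simp add: inner_diff_right inner_commute field_simps)
  qed
  then show thesis by (rule that)
qed

text \<open>\<open>adjoint\<close> is defined by choice, so its equation has to be earned by an
  existence proof; Riesz representation of \<open>x \<mapsto> K x \<bullet> y\<close> supplies
  it.\<close>

lemma adjoint_Hilbert: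
  fixes K :: "'a::{real_inner, complete_space} \<Rightarrow> 'b::real_inner"
  assumes "bounded_linear K"
  shows "K x \<bullet> y = x \<bullet> adjoint K y"
proof -
  have "\<exists>w. \<forall>x. K x \<bullet> y = x \<bullet> w" for y
    using Riesz_representation[OF bounded_linear_compose[OF bounded_linear_inner_left[of y] assms]]
    by metis
  then have "\<exists>f. \<forall>x y. K x \<bullet> y = x \<bullet> f y" by metis
  then have "\<forall>x y. K x \<bullet> y = x \<bullet> adjoint K y" unfolding adjoint_def by (rule someI_ex)
  then show ?thesis by blast
qed

text \<open>Uniform boundedness by Baire: one of the closed sets \<open>F m\<close> contains a ball,
  on which all functionals \<open>y \<mapsto> y \<bullet> x n\<close> are bounded by
  \<open>m\<close>.\<close>

lemma pointwise_bounded_imp_bounded: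
  fixes x :: "nat \<Rightarrow> 'a::{real_inner, complete_space}"
  assumes "\<And>y. bounded (range (\<lambda>n. y \<bullet> x n))"
  shows "bounded (range x)"
proof -
  define F where "F m = {y. \<forall>n. \<bar>y \<bullet> x n\<bar> \<le> real m}" for m :: nat
  have "closed (F m)" for m
    unfolding F_def by (intro closed_Collect_all closed_Collect_le continuous_intros)
  have "Met_TC.mcomplete (TYPE('a))"
    by (auto simp: Met_TC.mcomplete_def dest: Cauchy_convergent convergentD)
  have "y \<in> (\<Union>m. F m)" for y
  proof -
    obtain B where "\<forall>n. \<bar>y \<bullet> x n\<bar> \<le> B"
      using assms[of y] by (auto simp: bounded_iff)
    moreover obtain m :: nat where "B \<le> real m" using real_arch_simple by blast
    ultimately have "y \<in> F m" unfolding F_def using order_trans by blast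
    then show ?thesis by blast
  qed
  then have "(\<Union>m. F m) = UNIV" by blast
  then obtain m where "interior (F m) \<noteq> {}"
    using Met_TC.metric_Baire_category_alt[OF \<open>Met_TC.mcomplete (TYPE('a))\<close>, of "range F"]
      \<open>\<And>m. closed (F m)\<close> by fastforce
  then obtain a r where r: "r > 0" "cball a r \<subseteq> F m"
    by (metis all_not_in_conv mem_interior_cball)
  have "norm (x n) \<le> 2 * real m / r" for n
  proof (cases "x n = 0")
    case False
    \<comment> \<open>The point of the ball furthest in direction \<open>x n\<close>; subtracting
      the value at the centre isolates \<open>r * norm (x n)\<close>.\<close>
    define y where "y = a + (r / norm (x n)) *\<^sub>R x n"
    have "y \<in> cball a r" "a \<in> cball a r" using r(1) False by (simp_all add: y_def dist_norm)
    with r(2) have "y \<in> F m" "a \<in> F m" by blast+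
    then have "\<bar>y \<bullet> x n\<bar> \<le> real m" "\<bar>a \<bullet> x n\<bar> \<le> real m"
      by (auto simp: F_def)
    then have "y \<bullet> x n - a \<bullet> x n \<le> 2 * real m" by linarith
    also have "y \<bullet> x n - a \<bullet> x n = r * norm (x n)"
      using False by (simp add: y_def inner_add_left dot_square_norm power2_eq_square)
    finally show ?thesis using r by (simp add: field_simps)
  qed (use r in simp)
  then show ?thesis by (auto simp: bounded_iff)
qed

section \<open>Weakly convergent sequences\<close>

lemma weakly_converges_imp_bounded:
  fixes x :: "nat \<Rightarrow> 'a::{real_inner, complete_space}"
  assumes "weakly_converges x l"
  shows "bounded (range x)"
proof (rule pointwise_bounded_imp_bounded)
  fix y :: 'a
  have "(\<lambda>n. y \<bullet> x n) \<longlonglongrightarrow> y \<bullet> l"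
    using assms bounded_linear_inner_right unfolding weakly_converges_def by blast
  then show "bounded (range (\<lambda>n. y \<bullet> x n))" by (rule convergent_imp_bounded)
qed

lemma weakly_converges_bounded_linear:
  assumes "weakly_converges x l" "bounded_linear K"
  shows "weakly_converges (K \<circ> x) (K l)"
  using assms bounded_linear_compose unfolding weakly_converges_def comp_def by blast

lemma weak_limit_eq_limit:
  fixes x :: "nat \<Rightarrow> 'a::real_inner"
  assumes "weakly_converges x l" "x \<longlonglongrightarrow> m"
  shows "l = m"
proof -
  have "(\<lambda>n. x n \<bullet> (l - m)) \<longlonglongrightarrow> l \<bullet> (l - m)"
    using assms(1) bounded_linear_inner_left unfolding weakly_converges_def by blast
  moreover have "(\<lambda>n. x n \<bullet> (l - m)) \<longlonglongrightarrow> m \<bullet> (l - m)"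
    by (intro tendsto_intros assms)
  ultimately have "(l - m) \<bullet> (l - m) = 0"
    using LIMSEQ_unique by (metis inner_diff_left right_minus_eq)
  then show ?thesis by simp
qed

text \<open>If \<open>a\<close> is the projection of \<open>l\<close> onto \<open>S\<close>, the
  functional given by \<open>l - a\<close> is at most its value at \<open>a\<close> on all of
  \<open>S\<close>. This bound survives the weak limit and forces \<open>l = a\<close>.\<close>

lemma convex_closed_weakly_closed:
  fixes S :: "'a::{real_inner, complete_space} set"
  assumes "convex S" "closed S" "weakly_converges x l" "\<forall>\<^sub>F n in sequentially. x n \<in> S"
  shows "l \<in> S"
proof -
  have "S \<noteq> {}" using eventually_happens[OF assms(4)] by auto
  then obtain a where a: "a \<in> S" "\<And>y. y \<in> S \<Longrightarrow> (l - a) \<bullet> (y - a) \<le> 0"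
    using closest_point_Hilbert assms by blast
  have "(\<lambda>n. (l - a) \<bullet> x n) \<longlonglongrightarrow> (l - a) \<bullet> l"
    using assms(3) bounded_linear_inner_right unfolding weakly_converges_def by blast
  moreover have "\<forall>\<^sub>F n in sequentially. (l - a) \<bullet> x n \<le> (l - a) \<bullet> a"
    using assms(4) by eventually_elim (use a(2) in \<open>auto simp: inner_diff_right\<close>)
  ultimately have "(l - a) \<bullet> l \<le> (l - a) \<bullet> a"
    by (rule tendsto_upperbound) simp
  then have "(l - a) \<bullet> (l - a) \<le> 0" by (simp add: inner_diff_right)
  then have "l = a" by (metis inner_eq_zero_iff inner_ge_zero order_antisym right_minus_eq)
  with a show ?thesis by simp
qed

section \<open>Sublevel sets and weak lower semicontinuity\<close>

lemma convex_sublevel: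
  assumes "econvex J"
  shows "convex {u. J u \<le> ereal c}"
proof (rule convexI, simp)
  fix x y and s t :: real
  assume xy: "J x \<le> ereal c" "J y \<le> ereal c" and st: "0 \<le> s" "0 \<le> t" "s + t = 1"
  show "J (s *\<^sub>R x + t *\<^sub>R y) \<le> ereal c"
  \<comment> \<open>\<open>econvex\<close> speaks of weights strictly between 0 and 1 only.\<close>
  proof (cases "s = 0 \<or> t = 0")
    case False
    with st have s: "0 < s" "s < 1" "t = 1 - s" by auto
    then have "J (s *\<^sub>R x + t *\<^sub>R y) \<le> ereal s * J x + ereal t * J y"
      using assms unfolding econvex_def by blast
    also have "\<dots> \<le> ereal s * ereal c + ereal t * ereal c"
      using xy s by (intro add_mono ereal_mult_left_mono) auto
    also have "\<dots> = ereal c" using s by (simp add: algebra_simps flip: distrib_left)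
    finally show ?thesis .
  qed (use xy st in auto)
qed

lemma closed_sublevel:
  assumes "lower_semicontinuous J"
  shows "closed {u. J u \<le> c}"
proof -
  have "open {u. c < J u}"
  proof (subst open_subopen, rule ballI)
    fix u assume "u \<in> {u. c < J u}"
    then have u: "c < J u" by simp
    then have "c < J u" .
    also have "J u \<le> Liminf (at u) J" using assms by (simp add: lower_semicontinuous_def)
    finally have "\<forall>\<^sub>F v in at u. c < J v" by (rule less_LiminfD)
    then obtain T where T: "open T" "u \<in> T" "\<And>v. v \<in> T \<Longrightarrow> v \<noteq> u \<Longrightarrow> c < J v"
      unfolding eventually_at_topological by blast
    \<comment> \<open>The filter \<open>at u\<close> leaves out \<open>u\<close> itself, which is
      added here by hand.\<close>
    then have "T \<subseteq> {u. c < J u}" using u by (metis mem_Collect_eq subsetI)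
    with T show "\<exists>T. open T \<and> u \<in> T \<and> T \<subseteq> {u. c < J u}" by (intro exI[of _ T]) simp
  qed
  moreover have "{u. J u \<le> c} = - {u. c < J u}" by (auto simp: not_less)
  ultimately show ?thesis by (metis closed_Compl)
qed

lemma weakly_lower_semicontinuous:
  fixes J :: "'a::{real_inner, complete_space} \<Rightarrow> ereal"
  assumes "econvex J" "lower_semicontinuous J" "weakly_converges x l"
    and "\<forall>\<^sub>F n in sequentially. J (x n) \<le> ereal c"
  shows "J l \<le> ereal c"
  using convex_closed_weakly_closed[OF convex_sublevel[of J c] closed_sublevel[of J "ereal c"]] assms by simp

text \<open>An unbounded sequence contains terms with norm of \<open>x (s n)\<close> above
  \<open>n\<close>. No subsequence of these is bounded, whereas weakly convergent sequences
  are.\<close>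

lemma bounded_of_sublevel:
  fixes K :: "'a::{real_inner, complete_space} \<Rightarrow> 'b::real_normed_vector"
  assumes "weakly_compact_sublevels K J" "\<And>n::nat. ereal ((norm (K (x n)))\<^sup>2) + J (x n) \<le> ereal c"
  shows "bounded (range x)"
proof (rule ccontr)
  assume "\<not> bounded (range x)"
  then have "\<exists>m. norm (x m) > real n" for n
    by (auto simp: bounded_iff not_le)
  then obtain s where s: "\<And>n. norm (x (s n)) > real n" by metis
  have "\<forall>n. ereal ((norm (K ((x \<circ> s) n)))\<^sup>2) + J ((x \<circ> s) n) \<le> ereal c"
    using assms(2) by simp
  then obtain l r where "strict_mono r" "weakly_converges ((x \<circ> s) \<circ> r) l"
    using assms(1) unfolding weakly_compact_sublevels_def by blast
  then have "bounded (range ((x \<circ> s) \<circ> r))" using weakly_converges_imp_bounded by blast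
  then obtain B where B: "\<And>n. norm (x (s (r n))) \<le> B" by (auto simp: bounded_iff)
  obtain n :: nat where "B < real n" using reals_Archimedean2 by blast
  also have "real n \<le> real (r n)" using \<open>strict_mono r\<close> by (simp add: seq_suble)
  finally show False using B[of n] s[of "r n"] by simp
qed

section \<open>Optimality conditions\<close>

lemma weighted_Cauchy_Schwarz_sum:
  fixes a x :: "'i \<Rightarrow> real"
  assumes "\<And>i. i \<in> I \<Longrightarrow> 0 \<le> a i"
  shows "(\<Sum>i\<in>I. a i * x i)\<^sup>2 \<le> (\<Sum>i\<in>I. a i) * (\<Sum>i\<in>I. a i * (x i)\<^sup>2)"
proof -
  have "(\<Sum>i\<in>I. a i * x i) = (\<Sum>i\<in>I. sqrt (a i) * (sqrt (a i) * x i))"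
    using assms by (intro sum.cong) (simp_all flip: mult.assoc)
  moreover have "(\<Sum>i\<in>I. (sqrt (a i))\<^sup>2) = (\<Sum>i\<in>I. a i)"
    using assms by (intro sum.cong) simp_all
  moreover have "(\<Sum>i\<in>I. (sqrt (a i) * x i)\<^sup>2) = (\<Sum>i\<in>I. a i * (x i)\<^sup>2)"
    using assms by (intro sum.cong) (simp_all add: power_mult_distrib)
  ultimately show ?thesis
    using Cauchy_Schwarz_ineq_sum[of "\<lambda>i. sqrt (a i)" "\<lambda>i. sqrt (a i) * x i" I] by simp
qed

lemma norm_le_of_inner_le:
  fixes x y :: "'a::real_inner"
  assumes "x \<bullet> x \<le> x \<bullet> y"
  shows "norm x \<le> norm y"
proof (cases "x = 0")
  case False
  have "norm x * norm x \<le> norm x * norm y"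
    using assms norm_cauchy_schwarz[of x y] by (simp add: dot_square_norm power2_eq_square)
  then show ?thesis using False by simp
qed simp

lemma le_of_perturbation:
  fixes a b c :: real
  assumes "\<And>s. 0 < s \<Longrightarrow> s < 1 \<Longrightarrow> a \<le> b + s * c"
  shows "a \<le> b"
proof (rule tendsto_lowerbound)
  show "((\<lambda>s. b + s * c) \<longlongrightarrow> b) (at_right 0)"
    by (auto intro!: tendsto_eq_intros)
  show "\<forall>\<^sub>F s in at_right 0. a \<le> b + s * c"
    using eventually_at_right_real[of 0 "1::real"] by (auto elim!: eventually_mono intro: assms)
qed simp

lemma is_arg_min_imp_finite:
  assumes "proper J" "is_arg_min (alm_objective K J s gd q) (\<lambda>_. True) u"
  shows "\<bar>J u\<bar> \<noteq> \<infinity>"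
proof -
  obtain v where "J v < \<infinity>" "J v \<noteq> -\<infinity>"
    using assms(1) by (auto simp: proper_def effective_domain_def)
  then have "alm_objective K J s gd q v < \<infinity>"
    unfolding alm_objective_def by (cases "J v") auto
  moreover have "alm_objective K J s gd q u \<le> alm_objective K J s gd q v"
    using assms(2) by (simp add: is_arg_min_def not_less)
  ultimately have "alm_objective K J s gd q u < \<infinity>" by (rule le_less_trans[rotated])
  then show ?thesis
    using assms(1) unfolding alm_objective_def proper_def by (cases "J u") auto
qed

text \<open>First-order condition: the adjoint of \<open>K\<close> sends the updated multiplier
  \<open>q + s *\<^sub>R (gd - K u)\<close> to a subgradient of \<open>J\<close> at
  \<open>u\<close>. It comes from comparing \<open>u\<close> with a point of the segment towards
  \<open>v\<close>, dividing by the step \<open>z\<close>, and letting \<open>z\<close> tend to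
  0.\<close>

lemma alm_optimality:
  fixes K :: "'a::real_inner \<Rightarrow> 'b::real_inner"
  assumes K: "bounded_linear K" and J: "econvex J" "proper J"
    and min: "is_arg_min (alm_objective K J s gd q) (\<lambda>_. True) u" and v: "J v < \<infinity>"
  shows "real_of_ereal (J u) + (q + s *\<^sub>R (gd - K u)) \<bullet> (K v - K u) \<le> real_of_ereal (J v)"
proof -
  interpret bounded_linear K by fact
  obtain a where a: "J u = ereal a" using is_arg_min_imp_finite[OF J(2) min] by auto
  obtain b where b: "J v = ereal b" using v J(2) by (cases "J v") (auto simp: proper_def)
  define h where "h = K v - K u"
  have "a + (q + s *\<^sub>R (gd - K u)) \<bullet> h \<le> b + z * (s / 2 * (norm h)\<^sup>2)" if z: "0 < z" "z < 1" for z
  proof -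
    define w where "w = z *\<^sub>R v + (1 - z) *\<^sub>R u"
    have "J w \<le> ereal z * J v + ereal (1 - z) * J u"
      unfolding w_def using J(1) z by (simp add: econvex_def)
    then have Jw: "J w \<le> ereal (z * b + (1 - z) * a)" by (simp add: a b)
    then obtain c where c: "J w = ereal c" using J(2) by (cases "J w") (auto simp: proper_def)
    have "K w = K u + z *\<^sub>R h" by (simp add: w_def h_def add diff scaleR scaleR_diff_left scaleR_diff_right)
    then have Kw: "K w - gd = (K u - gd) + z *\<^sub>R h" by simp
    have "alm_objective K J s gd q u \<le> alm_objective K J s gd q w"
      using min by (simp add: is_arg_min_def not_less)
    then have "s / 2 * (norm (K u - gd))\<^sup>2 + a - q \<bullet> (K u - gd)
        \<le> s / 2 * (norm ((K u - gd) + z *\<^sub>R h))\<^sup>2 + c - q \<bullet> ((K u - gd) + z *\<^sub>R h)"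
      by (simp add: alm_objective_def a c Kw)
    also have "(norm ((K u - gd) + z *\<^sub>R h))\<^sup>2
        = (norm (K u - gd))\<^sup>2 + 2 * z * ((K u - gd) \<bullet> h) + z * (z * (norm h)\<^sup>2)"
      unfolding power2_norm_eq_inner by (simp add: inner_add_left inner_add_right inner_commute algebra_simps)
    finally have "a + z * ((q - s *\<^sub>R (K u - gd)) \<bullet> h) \<le> c + z * (z * (s / 2 * (norm h)\<^sup>2))"
      by (simp add: inner_add_right inner_diff_left algebra_simps)
    also have "c \<le> z * b + (1 - z) * a" using Jw c by simp
    finally have "z * (a + (q - s *\<^sub>R (K u - gd)) \<bullet> h) \<le> z * (b + z * (s / 2 * (norm h)\<^sup>2))"
      by (simp add: algebra_simps)
    moreover have "q - s *\<^sub>R (K u - gd) = q + s *\<^sub>R (gd - K u)" by (simp add: algebra_simps)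
    ultimately show ?thesis using z by simp
  qed
  then have "a + (q + s *\<^sub>R (gd - K u)) \<bullet> h \<le> b" by (rule le_of_perturbation)
  then show ?thesis by (simp add: a b h_def)
qed

lemma alm_time_Suc [simp]: "alm_time \<tau> (Suc n) = alm_time \<tau> n + \<tau> (Suc n)"
  by (simp add: alm_time_def)

lemma greaterThanAtMost_Suc: "m \<le> n \<Longrightarrow> {m<..Suc n} = insert (Suc n) {m<..n}"
  by auto

lemma alm_time_diff: "m \<le> n \<Longrightarrow> (\<Sum>i\<in>{m<..n}. \<tau> i) = alm_time \<tau> n - alm_time \<tau> m"
  by (induction n rule: nat_induct_at_least) (simp_all add: greaterThanAtMost_Suc)

section \<open>The Bregman distance along the iteration\<close>

locale augmented_lagrangian =
  fixes K :: "'a::{real_inner, complete_space} \<Rightarrow> 'b::real_inner"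
    and J :: "'a \<Rightarrow> ereal"
    and \<tau> :: "nat \<Rightarrow> real"
    and p0 :: 'b
    and R :: "nat \<Rightarrow> 'b \<Rightarrow> 'a"
    and Rs :: "nat \<Rightarrow> 'b \<Rightarrow> 'b"
  assumes K: "bounded_linear K"
    and J_convex: "econvex J"
    and J_lsc: "lower_semicontinuous J"
    and J_proper: "proper J"
    and compactness: "weakly_compact_sublevels K J"
    and tau_pos: "\<And>k. 1 \<le> k \<Longrightarrow> \<tau> k > 0"
    and t_at_top: "filterlim (alm_time \<tau>) at_top sequentially"
    and alm: "\<And>gd. alm_iteration K J \<tau> p0 gd (\<lambda>m. R m gd) (\<lambda>m. Rs m gd)"
begin

abbreviation t where "t \<equiv> alm_time \<tau>"

text \<open>Real values allow ordinary arithmetic; since infinite values are lost, finiteness of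
  \<open>J\<close> is tracked separately.\<close>

definition j where "j v = real_of_ereal (J v)"

definition res where "res n f = f - K (R n f)"

text \<open>The Bregman distance from \<open>R n f\<close> to \<open>v\<close> with the adjoint
  moved to the other side of the inner product.\<close>

definition D where "D n f v = j v - j (R n f) - Rs n f \<bullet> (K v - K (R n f))"

definition feasible where "feasible g v \<longleftrightarrow> J v < \<infinity> \<and> K v = g"

lemma J_eq: "J v < \<infinity> \<Longrightarrow> J v = ereal (j v)"
  using J_proper unfolding j_def proper_def by (cases "J v") auto

lemma R_Suc: "is_arg_min (alm_objective K J (\<tau> (Suc n)) f (Rs n f)) (\<lambda>_. True) (R (Suc n) f)"
  and Rs_Suc: "Rs (Suc n) f = Rs n f + \<tau> (Suc n) *\<^sub>R res (Suc n) f"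
proof -
  have "1 \<le> Suc n" by simp
  with alm[of f] show "is_arg_min (alm_objective K J (\<tau> (Suc n)) f (Rs n f)) (\<lambda>_. True) (R (Suc n) f)"
    and "Rs (Suc n) f = Rs n f + \<tau> (Suc n) *\<^sub>R res (Suc n) f"
    unfolding alm_iteration_def res_def by (metis diff_Suc_1)+
qed

lemma J_R: "J (R (Suc n) f) < \<infinity>"
  using is_arg_min_imp_finite[OF J_proper R_Suc, of n f] by auto

lemma Rs_0: "Rs 0 f = p0"
  using alm[of f] unfolding alm_iteration_def by blast

text \<open>This is the optimality condition of the step. Index 0 is excluded because
  \<open>R 0 f\<close> minimizes nothing.\<close>

lemma D_nonneg:
  assumes "J v < \<infinity>"
  shows "D (Suc n) f v \<ge> 0"
  using alm_optimality[OF K J_convex J_proper R_Suc assms, of n f] Rs_Suc[of n f]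
  by (simp add: D_def j_def res_def)

section \<open>Step-size sums and descent of the Bregman distance\<close>

lemma t_mono: "m \<le> n \<Longrightarrow> t m \<le> t n"
  by (rule lift_Suc_mono_le[of t]) (simp_all add: less_imp_le tau_pos)

lemma t_nonneg: "0 \<le> t n"
  using t_mono[of 0 n] by (simp add: alm_time_def)

lemma feasible_residual: "feasible g v \<Longrightarrow> K v - K (R n f) = res n f + (g - f)"
  by (simp add: feasible_def res_def)

lemma D_feasible: "feasible g v \<Longrightarrow> D n g v = j v - j (R n g) - Rs n g \<bullet> res n g"
  using feasible_residual[of g v n g] by (simp add: D_def)

text \<open>Three-point identity: \<open>D (Suc n) f v + D n f (R (Suc n) f)\<close> differs from
  \<open>D n f v\<close> only by the multiplier increment paired with
  \<open>K v - K (R (Suc n) f)\<close>. The second distance is dropped as nonnegative, which needs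
  \<open>n \<ge> 1\<close>.\<close>

lemma D_Suc_le:
  assumes "feasible g v" "n \<ge> 1"
  shows "D (Suc n) f v + \<tau> (Suc n) * ((norm (res (Suc n) f))\<^sup>2 - norm (g - f) * norm (res (Suc n) f))
    \<le> D n f v"
proof -
  let ?r = "res (Suc n) f"
  have "D n f (R (Suc n) f) \<ge> 0"
    using D_nonneg[OF J_R, of "n - 1" f n f] assms(2) by simp
  moreover have "D (Suc n) f v + D n f (R (Suc n) f)
      = D n f v - \<tau> (Suc n) * (?r \<bullet> (K v - K (R (Suc n) f)))"
    unfolding D_def Rs_Suc by (simp add: inner_add_left inner_diff_right algebra_simps)
  moreover have eq: "?r \<bullet> (K v - K (R (Suc n) f)) = (norm ?r)\<^sup>2 + ?r \<bullet> (g - f)"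
    using feasible_residual[OF assms(1)] by (simp add: inner_add_right power2_norm_eq_inner)
  moreover have "- (norm (g - f) * norm ?r) \<le> ?r \<bullet> (g - f)"
    using Cauchy_Schwarz_ineq2[of ?r "g - f"] by (simp add: mult.commute abs_le_iff)
  then have "\<tau> (Suc n) * ((norm ?r)\<^sup>2 - norm (g - f) * norm ?r)
      \<le> \<tau> (Suc n) * (?r \<bullet> (K v - K (R (Suc n) f)))"
    unfolding eq using tau_pos[of "Suc n"] by (intro mult_left_mono) auto
  ultimately show ?thesis by linarith
qed

lemma D_sum_le:
  assumes "feasible g v" "1 \<le> m" "m \<le> n"
  shows "D n f v + (\<Sum>i\<in>{m<..n}. \<tau> i * ((norm (res i f))\<^sup>2 - norm (g - f) * norm (res i f)))
    \<le> D m f v"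
  using assms(3)
proof (induction n rule: nat_induct_at_least)
  case (Suc n)
  then show ?case
    using D_Suc_le[OF assms(1), of n f] assms(2) by (simp add: greaterThanAtMost_Suc)
qed simp

lemma D_exact_sum_le:
  assumes "feasible g v" "1 \<le> m" "m \<le> n"
  shows "D n g v + (\<Sum>i\<in>{m<..n}. \<tau> i * (norm (res i g))\<^sup>2) \<le> D m g v"
  using D_sum_le[OF assms, of g] by simp

text \<open>The multiplier increments telescope to the sum of
  \<open>\<tau> i *\<^sub>R res i f\<close>; Cauchy-Schwarz with weights \<open>\<tau> i\<close>
  does the rest.\<close>

lemma Rs_diff_le:
  assumes "m \<le> n"
  shows "(norm (Rs n f - Rs m f))\<^sup>2 \<le> (t n - t m) * (\<Sum>i\<in>{m<..n}. \<tau> i * (norm (res i f))\<^sup>2)"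
proof -
  have pos: "0 \<le> \<tau> i" if "i \<in> {m<..n}" for i using tau_pos[of i] that by auto
  have "Rs n f - Rs m f = (\<Sum>i\<in>{m<..n}. \<tau> i *\<^sub>R res i f)"
    using assms by (induction n rule: nat_induct_at_least)
      (simp_all add: greaterThanAtMost_Suc Rs_Suc algebra_simps)
  then have "norm (Rs n f - Rs m f) \<le> (\<Sum>i\<in>{m<..n}. norm (\<tau> i *\<^sub>R res i f))"
    by (simp only: norm_sum)
  also have "\<dots> = (\<Sum>i\<in>{m<..n}. \<tau> i * norm (res i f))"
    using pos by (intro sum.cong) simp_all
  finally have "(norm (Rs n f - Rs m f))\<^sup>2 \<le> (\<Sum>i\<in>{m<..n}. \<tau> i * norm (res i f))\<^sup>2"
    by (intro power_mono) auto
  also have "\<dots> \<le> (\<Sum>i\<in>{m<..n}. \<tau> i) * (\<Sum>i\<in>{m<..n}. \<tau> i * (norm (res i f))\<^sup>2)"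
    by (intro weighted_Cauchy_Schwarz_sum pos)
  finally show ?thesis using alm_time_diff[OF assms, of \<tau>] by simp
qed

text \<open>Adding the two mutual Bregman distances cancels the values of \<open>J\<close>. The data
  may differ, which gives both monotone residuals and stability.\<close>

lemma subgradient_monotone:
  "(Rs (Suc n) f - Rs (Suc n') f') \<bullet> (K (R (Suc n) f) - K (R (Suc n') f')) \<ge> 0"
  using D_nonneg[OF J_R, of n f n' f'] D_nonneg[OF J_R, of n' f' n f]
  by (simp add: D_def inner_diff_left inner_diff_right)

lemma res_Suc_le: "norm (res (Suc (Suc n)) f) \<le> norm (res (Suc n) f)"
proof -
  let ?r = "res (Suc (Suc n)) f" and ?r' = "res (Suc n) f"
  have "0 \<le> \<tau> (Suc (Suc n)) * (?r \<bullet> (?r' - ?r))"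
    using subgradient_monotone[of "Suc n" f n f] unfolding Rs_Suc[of "Suc n"] by (simp add: res_def)
  then have "?r \<bullet> ?r \<le> ?r \<bullet> ?r'"
    using tau_pos[of "Suc (Suc n)"] by (simp add: zero_le_mult_iff inner_diff_right)
  then show ?thesis by (rule norm_le_of_inner_le)
qed

lemma res_antimono:
  assumes "1 \<le> m" "m \<le> n"
  shows "norm (res n f) \<le> norm (res m f)"
  using lift_Suc_antimono_le[of "\<lambda>n. norm (res (Suc n) f)" "m - 1" "n - 1"] res_Suc_le assms by simp

text \<open>By monotonicity a multiplier step is nonexpansive up to the change
  \<open>\<tau> (Suc n) *\<^sub>R (f - f')\<close> of the data, and both runs start at
  \<open>p0\<close>.\<close>

lemma Rs_stable: "norm (Rs n f - Rs n f') \<le> t n * norm (f - f')"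
proof (induction n)
  case (Suc n)
  let ?d = "Rs (Suc n) f - Rs (Suc n) f'" and ?e = "Rs n f - Rs n f'"
  have "\<tau> (Suc n) *\<^sub>R (K (R (Suc n) f) - K (R (Suc n) f')) = \<tau> (Suc n) *\<^sub>R (f - f') + ?e - ?d"
    unfolding Rs_Suc by (simp add: res_def algebra_simps)
  moreover have "0 \<le> ?d \<bullet> (\<tau> (Suc n) *\<^sub>R (K (R (Suc n) f) - K (R (Suc n) f')))"
    using subgradient_monotone[of n f n f'] tau_pos[of "Suc n"] by simp
  ultimately have "?d \<bullet> ?d \<le> ?d \<bullet> (\<tau> (Suc n) *\<^sub>R (f - f') + ?e)"
    by (simp add: inner_diff_right)
  then have "norm ?d \<le> norm (\<tau> (Suc n) *\<^sub>R (f - f') + ?e)"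
    by (rule norm_le_of_inner_le)
  also have "\<dots> \<le> \<tau> (Suc n) * norm (f - f') + norm ?e"
    using norm_triangle_ineq[of "\<tau> (Suc n) *\<^sub>R (f - f')" ?e] tau_pos[of "Suc n"] by simp
  also have "\<dots> \<le> t (Suc n) * norm (f - f')" using Suc by (simp add: algebra_simps)
  finally show ?case .
qed (simp add: Rs_0 alm_time_def)

section \<open>Continuity in the data at a fixed index\<close>

lemma Rs_tendsto:
  assumes "gs \<longlonglongrightarrow> g"
  shows "(\<lambda>k. Rs n (gs k)) \<longlonglongrightarrow> Rs n g"
proof (rule LIM_zero_cancel, rule Lim_null_comparison)
  show "(\<lambda>k. t n * norm (gs k - g)) \<longlonglongrightarrow> 0"
    using assms by (intro tendsto_mult_right_zero tendsto_norm_zero LIM_zero)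
qed (simp add: Rs_stable)

text \<open>The minimizers are arbitrary choices, but the residual is determined by two consecutive
  multipliers.\<close>

lemma res_tendsto:
  assumes "gs \<longlonglongrightarrow> g"
  shows "(\<lambda>k. res (Suc n) (gs k)) \<longlonglongrightarrow> res (Suc n) g"
proof -
  have "res (Suc n) f = (Rs (Suc n) f - Rs n f) /\<^sub>R \<tau> (Suc n)" for f
    using tau_pos[of "Suc n"] by (simp add: Rs_Suc)
  then show ?thesis by (auto intro!: tendsto_intros Rs_tendsto assms)
qed

text \<open>The two sides differ by \<open>D (Suc n) g (R (Suc n) f)\<close>, which is nonnegative.
  The bound thus needs no convergence of the primal iterates or of their
  \<open>J\<close>-values.\<close>

lemma D_le_perturbed:
  "D (Suc n) f v \<le> D (Suc n) g v + (Rs (Suc n) g - Rs (Suc n) f) \<bullet> (K v - K (R (Suc n) f))"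
  using D_nonneg[OF J_R, of n g n f] by (simp add: D_def inner_diff_left inner_diff_right)

lemma D_eventually_less:
  assumes "gs \<longlonglongrightarrow> g" "feasible g v" "D (Suc n) g v < e"
  shows "\<forall>\<^sub>F k in sequentially. D (Suc n) (gs k) v < e"
proof -
  have "(\<lambda>k. D (Suc n) g v + (Rs (Suc n) g - Rs (Suc n) (gs k)) \<bullet> (res (Suc n) (gs k) + (g - gs k)))
    \<longlonglongrightarrow> D (Suc n) g v + (Rs (Suc n) g - Rs (Suc n) g) \<bullet> (res (Suc n) g + (g - g))"
    by (intro tendsto_intros Rs_tendsto res_tendsto assms)
  then have "\<forall>\<^sub>F k in sequentially. D (Suc n) g v
      + (Rs (Suc n) g - Rs (Suc n) (gs k)) \<bullet> (res (Suc n) (gs k) + (g - gs k)) < e"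
    using assms(3) by (intro order_tendstoD(2)) auto
  then show ?thesis
  proof eventually_elim
    case (elim k)
    then show ?case
      using D_le_perturbed[of n "gs k" v g] by (simp add: feasible_residual[OF assms(2)])
  qed
qed

end

section \<open>Exact data and strong duality\<close>

lemma decseq_nonneg_small_drop:
  fixes d :: "nat \<Rightarrow> real"
  assumes "decseq d" "\<And>n. 0 \<le> d n" "0 < e"
  obtains M where "\<And>n. d M - d n < e"
proof -
  obtain L where L: "d \<longlonglongrightarrow> L" "\<And>i. L \<le> d i"
    using decseq_convergent[OF assms(1), of 0] assms(2) by blast
  have "\<forall>\<^sub>F n in sequentially. d n < L + e"
    using L(1) assms(3) by (intro order_tendstoD(2)) auto
  then obtain M where "d M < L + e" by (auto simp: eventually_sequentially)
  then show thesis using L(2) that[of M] by (smt (verit))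
qed

context augmented_lagrangian
begin

text \<open>The descent sum is finite, and by monotonicity every residual in it is at least the last
  one.\<close>

lemma exact_rate:
  assumes "feasible g v"
  obtains C where "C \<ge> 0" "\<And>n. t (Suc n) * (norm (res (Suc n) g))\<^sup>2 \<le> C"
proof
  \<comment> \<open>The descent starts at index 1, so the first step is accounted for by the extra
    term.\<close>
  define C where "C = D 1 g v + t 1 * (norm (res 1 g))\<^sup>2"
  have D1: "0 \<le> D 1 g v" using D_nonneg[of v 0 g] assms by (simp add: feasible_def)
  then show "C \<ge> 0" using t_nonneg[of 1] by (simp add: C_def)
  show "t (Suc n) * (norm (res (Suc n) g))\<^sup>2 \<le> C" for n
  proof -
    let ?x = "(norm (res (Suc n) g))\<^sup>2"
    have le: "?x \<le> (norm (res i g))\<^sup>2" if "1 \<le> i" "i \<le> Suc n" for i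
      using res_antimono that by (simp add: power_mono)
    have "(t (Suc n) - t 1) * ?x = (\<Sum>i\<in>{1<..Suc n}. \<tau> i * ?x)"
      using alm_time_diff[of 1 "Suc n" \<tau>] by (simp flip: sum_distrib_right)
    also have "\<dots> \<le> (\<Sum>i\<in>{1<..Suc n}. \<tau> i * (norm (res i g))\<^sup>2)"
      by (intro sum_mono mult_left_mono le less_imp_le[OF tau_pos]) auto
    also have "\<dots> \<le> D 1 g v"
      using D_exact_sum_le[OF assms, of 1 "Suc n"] D_nonneg[of v n g] assms
      by (simp add: feasible_def)
    finally have "(t (Suc n) - t 1) * ?x \<le> D 1 g v" .
    moreover have "t 1 * ?x \<le> t 1 * (norm (res 1 g))\<^sup>2"
      using le[of 1] t_nonneg[of 1] by (simp add: mult_left_mono)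
    ultimately show ?thesis unfolding C_def by (simp add: algebra_simps)
  qed
qed

lemma exact_res_tendsto_0:
  assumes "feasible g v"
  shows "(\<lambda>n. res (Suc n) g) \<longlonglongrightarrow> 0"
proof -
  obtain C where C: "C \<ge> 0" "\<And>n. t (Suc n) * (norm (res (Suc n) g))\<^sup>2 \<le> C"
    using exact_rate[OF assms] by blast
  have tpos: "t (Suc n) > 0" for n
    using t_nonneg[of n] tau_pos[of "Suc n"] by simp
  have "(\<lambda>n. (norm (res (Suc n) g))\<^sup>2) \<longlonglongrightarrow> 0"
  proof (rule Lim_null_comparison)
    show "\<forall>\<^sub>F n in sequentially. norm ((norm (res (Suc n) g))\<^sup>2) \<le> C / t (Suc n)"
      using C(2) tpos by (simp add: pos_le_divide_eq mult.commute del: alm_time_Suc)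
    show "(\<lambda>n. C / t (Suc n)) \<longlonglongrightarrow> 0"
      by (intro real_tendsto_divide_at_top[OF tendsto_const] filterlim_compose[OF t_at_top filterlim_Suc])
  qed
  then show ?thesis by (simp add: tendsto_norm_zero_iff)
qed

text \<open>The multiplier is split at a late index \<open>Suc M\<close>. The fixed part meets
  residuals tending to 0; for the rest, the square of the product of norms is at most a small tail
  of the descent sum times the bounded
  \<open>t (Suc n) * (norm (res (Suc n) g))\<^sup>2\<close>.\<close>

lemma exact_inner_tendsto_0:
  assumes "feasible g v"
  shows "(\<lambda>n. Rs (Suc n) g \<bullet> res (Suc n) g) \<longlonglongrightarrow> 0"
proof (rule LIMSEQ_I, simp only: diff_0_right)
  fix e :: real assume e: "e > 0"
  obtain C where C: "C \<ge> 0" "\<And>n. t (Suc n) * (norm (res (Suc n) g))\<^sup>2 \<le> C"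
    using exact_rate[OF assms] by blast
  \<comment> \<open>Chosen so that \<open>e' * C < (e/2)\<^sup>2\<close>; adding 1 keeps the
    denominator positive when \<open>C = 0\<close>.\<close>
  define e' where "e' = (e/2)\<^sup>2 / (C + 1)"
  have e': "e' > 0" "e' * C < (e/2)\<^sup>2"
    using e C(1) by (simp_all add: e'_def field_simps)
  have dec: "decseq (\<lambda>n. D (Suc n) g v)"
  proof (rule decseq_SucI)
    fix n
    have "0 \<le> \<tau> (Suc (Suc n)) * (norm (res (Suc (Suc n)) g))\<^sup>2"
      using tau_pos[of "Suc (Suc n)"] by simp
    then show "D (Suc (Suc n)) g v \<le> D (Suc n) g v"
      using D_Suc_le[OF assms, of "Suc n" g] by simp
  qed
  have nonneg: "0 \<le> D (Suc n) g v" for n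
    using D_nonneg assms by (simp add: feasible_def)
  obtain M where M: "\<And>n. D (Suc M) g v - D (Suc n) g v < e'"
    using decseq_nonneg_small_drop[OF dec nonneg e'(1)] by blast
  have "(\<lambda>n. norm (Rs (Suc M) g) * norm (res (Suc n) g)) \<longlonglongrightarrow> 0"
    by (intro tendsto_mult_right_zero tendsto_norm_zero exact_res_tendsto_0[OF assms])
  then have "\<forall>\<^sub>F n in sequentially. norm (Rs (Suc M) g) * norm (res (Suc n) g) < e/2"
    using e by (intro order_tendstoD(2)) auto
  moreover have "\<forall>\<^sub>F n in sequentially. n \<ge> M" by (rule eventually_ge_at_top)
  ultimately have "\<forall>\<^sub>F n in sequentially. norm (Rs (Suc n) g \<bullet> res (Suc n) g) < e"
  proof eventually_elim
    case (elim n)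
    let ?r = "norm (res (Suc n) g)" and ?d = "norm (Rs (Suc n) g - Rs (Suc M) g)"
    let ?S = "\<Sum>i\<in>{Suc M<..Suc n}. \<tau> i * (norm (res i g))\<^sup>2"
    have S: "?S \<le> e'"
      using D_exact_sum_le[OF assms, of "Suc M" "Suc n"] M[of n] elim(2) by simp
    have "?d\<^sup>2 \<le> (t (Suc n) - t (Suc M)) * ?S"
      using elim(2) by (intro Rs_diff_le) simp
    also have "\<dots> \<le> t (Suc n) * e'"
      using S e'(1) t_nonneg[of "Suc M"] t_nonneg[of "Suc n"] t_mono[of "Suc M" "Suc n"] elim(2)
      by (intro mult_mono' order_trans[OF _ S]) (auto intro!: sum_nonneg mult_nonneg_nonneg less_imp_le[OF tau_pos] simp del: alm_time_Suc)
    finally have "(?d * ?r)\<^sup>2 \<le> (t (Suc n) * e') * ?r\<^sup>2"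
      by (simp add: power_mult_distrib mult_right_mono del: alm_time_Suc)
    also have "\<dots> \<le> e' * C"
      using mult_left_mono[OF C(2)[of n], of e'] e'(1) by (simp add: ac_simps del: alm_time_Suc)
    also have "\<dots> < (e/2)\<^sup>2" by (rule e'(2))
    finally have "?d * ?r < e/2"
      by (rule power_less_imp_less_base) (use e in simp)
    moreover have "norm (Rs (Suc n) g \<bullet> res (Suc n) g) \<le> norm (Rs (Suc n) g) * ?r"
      using Cauchy_Schwarz_ineq2 by simp
    moreover have "norm (Rs (Suc n) g) * ?r \<le> (?d + norm (Rs (Suc M) g)) * ?r"
      using norm_triangle_sub[of "Rs (Suc n) g" "Rs (Suc M) g"] by (intro mult_right_mono) auto
    ultimately show ?case using elim(1) by (simp add: algebra_simps)
  qed
  then show "\<exists>N. \<forall>n\<ge>N. norm (Rs (Suc n) g \<bullet> res (Suc n) g) < e"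
    by (simp add: eventually_sequentially)
qed

lemma j_lsc:
  assumes "weakly_converges y l" "\<forall>\<^sub>F n in sequentially. J (y n) < \<infinity> \<and> j (y n) \<le> c"
  shows "J l < \<infinity>" "j l \<le> c"
proof -
  have "J l \<le> ereal c"
  proof (rule weakly_lower_semicontinuous[OF J_convex J_lsc assms(1)])
    show "\<forall>\<^sub>F n in sequentially. J (y n) \<le> ereal c"
      using assms(2) by eventually_elim (simp add: J_eq)
  qed
  then show "J l < \<infinity>" by (rule le_less_trans) simp
  then show "j l \<le> c" using \<open>J l \<le> ereal c\<close> by (simp add: J_eq)
qed

lemma weak_cluster_feasible:
  assumes "weakly_converges y l" "(\<lambda>n. K (y n)) \<longlonglongrightarrow> g"
  shows "K l = g"
  using weak_limit_eq_limit[OF weakly_converges_bounded_linear[OF assms(1) K], of g] assms(2)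
  by (simp add: comp_def)

text \<open>Strong duality: the exact iterates certify the optimal value up to any tolerance.\<close>

lemma exact_minimizer:
  assumes "feasible g v0"
  obtains w where "feasible g w" "\<And>v. feasible g v \<Longrightarrow> j w \<le> j v"
    "\<And>e. e > 0 \<Longrightarrow> \<exists>n. D (Suc n) g w < e"
proof -
  define x where "x n = R (Suc n) g" for n
  define a where "a n = Rs (Suc n) g \<bullet> res (Suc n) g" for n
  have a0: "a \<longlonglongrightarrow> 0" unfolding a_def by (rule exact_inner_tendsto_0[OF assms])
  have Jx: "J (x n) < \<infinity>" for n unfolding x_def by (rule J_R)
  have D_eq: "D (Suc n) g v = j v - j (x n) - a n" if "feasible g v" for n v
    using D_feasible[OF that] by (simp add: x_def a_def)
  have jx: "j (x n) \<le> j v - a n" if "feasible g v" for n v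
    using D_nonneg[of v n g] D_eq[OF that, of n] that by (simp add: feasible_def)
  have "(\<lambda>n. g - res (Suc n) g) \<longlonglongrightarrow> g - 0"
    by (intro tendsto_intros exact_res_tendsto_0[OF assms])
  then have Kx: "(\<lambda>n. K (x n)) \<longlonglongrightarrow> g" by (simp add: res_def x_def)
  obtain A where A: "\<And>n. \<bar>a n\<bar> \<le> A"
    using convergent_imp_bounded[OF a0] by (auto simp: bounded_iff)
  obtain B where B: "\<And>n. norm (K (x n)) \<le> B"
    using convergent_imp_bounded[OF Kx] by (auto simp: bounded_iff)
  have "ereal ((norm (K (x n)))\<^sup>2) + J (x n) \<le> ereal (B\<^sup>2 + (j v0 + A))" for n
  proof -
    have "(norm (K (x n)))\<^sup>2 \<le> B\<^sup>2" using B[of n] by (simp add: power_mono)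
    moreover have "j (x n) \<le> j v0 + A" using jx[OF assms, of n] A[of n] by linarith
    ultimately show ?thesis by (simp add: J_eq[OF Jx])
  qed
  then obtain l r where r: "strict_mono r" and l: "weakly_converges (x \<circ> r) l"
    using compactness unfolding weakly_compact_sublevels_def by blast
  have Kl: "K l = g"
    using weak_cluster_feasible[OF l] LIMSEQ_subseq_LIMSEQ[OF Kx r] by (simp add: comp_def)
  have ar0: "(\<lambda>n. a (r n)) \<longlonglongrightarrow> 0"
    using LIMSEQ_subseq_LIMSEQ[OF a0 r] by (simp add: comp_def)
  have ar: "\<forall>\<^sub>F n in sequentially. \<bar>a (r n)\<bar> < e" if "e > 0" for e
    using order_tendstoD(2)[OF tendsto_rabs_zero[OF ar0] that] .
  \<comment> \<open>Used three times: for finiteness of \<open>J l\<close>, with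
    \<open>c = j v\<close> for minimality, and with \<open>c = j l - e\<close> for the small Bregman
    distance.\<close>
  have lsc: "J l < \<infinity>" "j l \<le> c + e" if "\<And>n. j (x n) \<le> c - a n" "e > 0" for c e
  proof -
    have "\<forall>\<^sub>F n in sequentially. J ((x \<circ> r) n) < \<infinity> \<and> j ((x \<circ> r) n) \<le> c + e"
      using ar[OF that(2)]
    proof eventually_elim
      case (elim n)
      then show ?case using that(1)[of "r n"] Jx by simp
    qed
    from j_lsc[OF l this] show "J l < \<infinity>" "j l \<le> c + e" by auto
  qed
  have feas: "feasible g l"
    using lsc(1)[OF jx[OF assms], of 1] Kl by (simp add: feasible_def)
  moreover have "j l \<le> j v" if "feasible g v" for v
    using lsc(2)[OF jx[OF that]] by (rule field_le_epsilon)
  moreover have "\<exists>n. D (Suc n) g l < e" if e: "e > 0" for e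
  proof (rule ccontr)
    assume "\<nexists>n. D (Suc n) g l < e"
    \<comment> \<open>If every distance were at least \<open>e\<close>, the iterates would stay
      below \<open>j l - e\<close> up to \<open>a n\<close>, and lower semicontinuity would give
      \<open>j l \<le> j l - e/2\<close>.\<close>
    then have "j (x n) \<le> (j l - e) - a n" for n
      using D_eq[OF feas, of n] by (simp add: not_less) (smt (verit))
    from lsc(2)[OF this, of "e/2"] e show False by simp
  qed
  ultimately show thesis by (rule that)
qed

text \<open>Otherwise every step lowers the nonnegative Bregman distance by at least
  \<open>\<tau> i * c\<close> with a fixed \<open>c > 0\<close>, although the step sizes have a
  divergent sum.\<close>

lemma discrepancy_reached:
  assumes "feasible g v" "norm (f - g) \<le> d" "d > 0" "\<rho> > 1"
  shows "\<exists>n\<ge>1. norm (K (R n f) - f) < \<rho> * d"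
proof (rule ccontr)
  assume "\<not> ?thesis"
  then have large: "\<rho> * d \<le> norm (res n f)" if "n \<ge> 1" for n
    using that by (auto simp: res_def norm_minus_commute not_less)
  \<comment> \<open>The lower bound \<open>\<rho> * d\<close> of a residual times the least excess
    \<open>(\<rho> - 1) * d\<close> of a residual over the noise.\<close>
  define c where "c = (\<rho> * d) * ((\<rho> - 1) * d)"
  have c: "c > 0" using assms by (simp add: c_def)
  have "(t n - t 1) * c \<le> D 1 f v" if n: "n \<ge> 1" for n
  proof -
    have le: "c \<le> (norm (res i f))\<^sup>2 - norm (g - f) * norm (res i f)" if "i \<ge> 1" for i
    proof -
      have "(\<rho> - 1) * d \<le> norm (res i f) - norm (g - f)"
        using large[OF that] assms(2) by (simp add: norm_minus_commute algebra_simps)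
      then have "c \<le> norm (res i f) * (norm (res i f) - norm (g - f))"
        unfolding c_def using large[OF that] assms by (intro mult_mono) auto
      then show ?thesis by (simp add: algebra_simps power2_eq_square)
    qed
    have "(t n - t 1) * c = (\<Sum>i\<in>{1<..n}. \<tau> i * c)"
      using alm_time_diff[OF n, of \<tau>] by (simp flip: sum_distrib_right)
    also have "\<dots> \<le> (\<Sum>i\<in>{1<..n}. \<tau> i * ((norm (res i f))\<^sup>2 - norm (g - f) * norm (res i f)))"
      by (intro sum_mono mult_left_mono le less_imp_le[OF tau_pos]) auto
    also have "\<dots> \<le> D 1 f v"
      using D_sum_le[OF assms(1), of 1 n f] D_nonneg[of v "n - 1" f] assms(1) n
      by (simp add: feasible_def)
    finally show ?thesis .
  qed
  then have "t n \<le> t 1 + D 1 f v / c" if "n \<ge> 1" for n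
    using that c by (simp add: field_simps)
  moreover have "\<forall>\<^sub>F n in sequentially. t n > t 1 + D 1 f v / c \<and> n \<ge> 1"
    using t_at_top by (intro eventually_conj eventually_ge_at_top) (simp add: filterlim_at_top_dense)
  then obtain n where "t n > t 1 + D 1 f v / c" "n \<ge> 1"
    by (auto simp: eventually_sequentially)
  ultimately show False by (meson not_less)
qed

end

section \<open>Noisy data up to the stopping index\<close>

locale morozov_stopping = augmented_lagrangian K J \<tau> p0 R Rs
  for K :: "'a::{real_inner, complete_space} \<Rightarrow> 'b::real_inner"
    and J \<tau> p0 R Rs +
  fixes g :: 'b and \<rho> b :: real and \<delta> :: "nat \<Rightarrow> real"
    and gs :: "nat \<Rightarrow> 'b" and n :: "nat \<Rightarrow> nat"
  assumes attainable: "\<exists>v. feasible g v"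
    and tau_le: "\<And>k. 1 \<le> k \<Longrightarrow> \<tau> k \<le> b"
    and rho: "\<rho> > 1"
    and delta_pos: "\<And>k. \<delta> k > 0"
    and delta_lim: "\<delta> \<longlonglongrightarrow> 0"
    and noise: "\<And>k. norm (gs k - g) \<le> \<delta> k"
    and n_def: "\<And>k. n k = morozov K R \<rho> (\<delta> k) (gs k)"
    and n_lim: "filterlim n at_top sequentially"
begin

section \<open>Behaviour of the run before and at the stopping index\<close>

lemma gs_lim: "gs \<longlonglongrightarrow> g"
  using Lim_null_comparison[of "\<lambda>k. gs k - g" \<delta>] noise delta_lim by (simp add: LIM_zero_iff)

lemma b_nonneg: "b \<ge> 0"
  using tau_pos[of 1] tau_le[of 1] by simp

lemma stopping_index: "1 \<le> n k" "norm (res (n k) (gs k)) < \<rho> * \<delta> k"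
proof -
  obtain v where "feasible g v" using attainable by blast
  from discrepancy_reached[OF this noise delta_pos rho]
  have "1 \<le> n k \<and> norm (K (R (n k) (gs k)) - gs k) < \<rho> * \<delta> k"
    unfolding n_def morozov_def by (rule LeastI_ex)
  then show "1 \<le> n k" "norm (res (n k) (gs k)) < \<rho> * \<delta> k"
    by (auto simp: res_def norm_minus_commute)
qed

lemma before_stopping:
  assumes "1 \<le> i" "i < n k"
  shows "\<rho> * \<delta> k \<le> norm (res i (gs k))"
  using not_less_Least[of i "\<lambda>m. 1 \<le> m \<and> norm (K (R m (gs k)) - gs k) < \<rho> * \<delta> k"] assms
  by (simp add: n_def morozov_def res_def norm_minus_commute)

text \<open>Before stopping, the residual is at least \<open>\<rho>\<close> times the noise level.
  The first bound controls the growth of the multipliers, the second the size of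
  \<open>(\<delta> k)\<^sup>2\<close> times the elapsed time.\<close>

lemma residual_gain:
  assumes "1 \<le> i" "i < n k"
  shows "(\<rho> - 1) * (norm (res i (gs k)))\<^sup>2
      \<le> \<rho> * ((norm (res i (gs k)))\<^sup>2 - norm (g - gs k) * norm (res i (gs k)))"
    and "(\<rho> - 1) * \<rho> * (\<delta> k)\<^sup>2
      \<le> (norm (res i (gs k)))\<^sup>2 - norm (g - gs k) * norm (res i (gs k))"
proof -
  let ?x = "norm (res i (gs k))" and ?d = "norm (g - gs k)"
  have d: "?d \<le> \<delta> k" using noise[of k] by (simp add: norm_minus_commute)
  have x: "\<rho> * \<delta> k \<le> ?x" using before_stopping[OF assms] .
  have "\<rho> * ?d \<le> ?x" using mult_left_mono[OF d, of \<rho>] rho x by linarith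
  then have "\<rho> * ?d * ?x \<le> ?x * ?x" by (intro mult_right_mono) auto
  then show "(\<rho> - 1) * ?x\<^sup>2 \<le> \<rho> * (?x\<^sup>2 - ?d * ?x)"
    by (simp add: algebra_simps power2_eq_square)
  have "(\<rho> * \<delta> k) * ((\<rho> - 1) * \<delta> k) \<le> ?x * (?x - ?d)"
    using x d rho delta_pos[of k] by (intro mult_mono) (auto simp: algebra_simps)
  then show "(\<rho> - 1) * \<rho> * (\<delta> k)\<^sup>2 \<le> ?x\<^sup>2 - ?d * ?x"
    by (simp add: algebra_simps power2_eq_square)
qed

text \<open>The step that meets the discrepancy principle may increase the distance, but by at most
  \<open>\<tau> (Suc N)\<close> times noise times residual, and that residual is below
  \<open>\<rho> * \<delta> k\<close>.\<close>

lemma last_step: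
  assumes "feasible g v" "n k = Suc N" "1 \<le> N"
  shows "D (Suc N) (gs k) v \<le> D N (gs k) v + b * \<rho> * (\<delta> k)\<^sup>2"
proof -
  let ?x = "norm (res (Suc N) (gs k))" and ?d = "norm (g - gs k)"
  have "?d * ?x \<le> \<delta> k * (\<rho> * \<delta> k)"
    using noise[of k] stopping_index(2)[of k] assms(2) delta_pos[of k]
    by (intro mult_mono) (auto simp: norm_minus_commute)
  then have "?d * ?x \<le> \<rho> * (\<delta> k)\<^sup>2" by (simp add: power2_eq_square mult.left_commute)
  moreover have "?d * ?x - ?x\<^sup>2 \<le> ?d * ?x" by simp
  ultimately have "?d * ?x - ?x\<^sup>2 \<le> \<rho> * (\<delta> k)\<^sup>2" by (rule order_trans[rotated])
  then have "\<tau> (Suc N) * (?d * ?x - ?x\<^sup>2) \<le> \<tau> (Suc N) * (\<rho> * (\<delta> k)\<^sup>2)"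
    using tau_pos[of "Suc N"] by (intro mult_left_mono) auto
  also have "\<dots> \<le> b * (\<rho> * (\<delta> k)\<^sup>2)"
    using tau_le[of "Suc N"] rho by (intro mult_right_mono) auto
  finally have "- (\<tau> (Suc N) * (?x\<^sup>2 - ?d * ?x)) \<le> b * \<rho> * (\<delta> k)\<^sup>2"
    by (simp add: algebra_simps)
  then show ?thesis using D_Suc_le[OF assms(1,3), of "gs k"] by linarith
qed

text \<open>From \<open>Suc m\<close> to \<open>N\<close>, the last index before stopping, the total
  descent \<open>?G\<close> is at most the starting distance, which is below \<open>e\<close> for
  late \<open>k\<close>. The two bounds of \<open>residual_gain\<close> turn this into the first two
  estimates; \<open>last_step\<close> adds the final increment in the third.\<close>

lemma noisy_run_estimates:
  assumes w: "feasible g w" and m: "D (Suc m) g w < e"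
  shows "\<forall>\<^sub>F k in sequentially. \<exists>N. n k = Suc N \<and> Suc m \<le> N \<and>
    (\<rho> - 1) * \<rho> * (\<delta> k)\<^sup>2 * (t N - t (Suc m)) \<le> e \<and>
    (\<rho> - 1) * (\<delta> k * norm (Rs N (gs k) - Rs (Suc m) (gs k))) \<le> e \<and>
    D (n k) (gs k) w \<le> e + b * \<rho> * (\<delta> k)\<^sup>2"
proof -
  have "\<forall>\<^sub>F k in sequentially. Suc (Suc m) \<le> n k"
    using n_lim by (simp add: filterlim_at_top)
  with D_eventually_less[OF gs_lim w m] show ?thesis
  proof eventually_elim
    case (elim k)
    then obtain N where N: "n k = Suc N" "Suc m \<le> N"
      by (metis Suc_le_D Suc_le_mono)
    let ?x = "\<lambda>i. norm (res i (gs k))" and ?I = "{Suc m<..N}"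
    let ?G = "\<Sum>i\<in>?I. \<tau> i * ((?x i)\<^sup>2 - norm (g - gs k) * ?x i)"
    let ?d = "norm (Rs N (gs k) - Rs (Suc m) (gs k))" and ?T = "t N - t (Suc m)"
    have \<tau>: "0 \<le> \<tau> i" if "i \<in> ?I" for i using that tau_pos[of i] by simp
    have i: "1 \<le> i" "i < n k" if "i \<in> ?I" for i using that N by auto
    have e: "e > 0"
      using elim(1) D_nonneg[of w m "gs k"] w by (simp add: feasible_def)
    have T: "?T = (\<Sum>i\<in>?I. \<tau> i)" using alm_time_diff[OF N(2), of \<tau>] by simp
    have "D N (gs k) w + ?G \<le> e"
      using D_sum_le[OF w, of "Suc m" N "gs k"] N(2) elim(1) by simp
    moreover have "0 \<le> D N (gs k) w"
      using D_nonneg[of w "N - 1" "gs k"] w N(2) by (simp add: feasible_def)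
    moreover have "(\<rho> - 1) * \<rho> * (\<delta> k)\<^sup>2 * ?T \<le> ?G"
      unfolding T sum_distrib_left
      by (intro sum_mono) (metis mult.commute mult_left_mono residual_gain(2) i \<tau>)
    moreover have "0 \<le> (\<rho> - 1) * \<rho> * (\<delta> k)\<^sup>2 * ?T"
      using rho t_mono[OF N(2)] by simp
    ultimately have G: "?G \<le> e" and DN: "D N (gs k) w \<le> e"
      and rate: "(\<rho> - 1) * \<rho> * (\<delta> k)\<^sup>2 * ?T \<le> e" by linarith+
    have "D (n k) (gs k) w \<le> e + b * \<rho> * (\<delta> k)\<^sup>2"
      using last_step[OF w N(1)] N DN by simp
    moreover have "(\<rho> - 1) * (\<delta> k * ?d) \<le> e"
    proof (rule power2_le_imp_le)
      let ?S = "\<Sum>i\<in>?I. \<tau> i * (?x i)\<^sup>2"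
      have "(\<rho> - 1) * ?S \<le> \<rho> * ?G"
        unfolding sum_distrib_left
      proof (rule sum_mono)
        fix l assume l: "l \<in> ?I"
        show "(\<rho> - 1) * (\<tau> l * (?x l)\<^sup>2)
            \<le> \<rho> * (\<tau> l * ((?x l)\<^sup>2 - norm (g - gs k) * ?x l))"
          using mult_left_mono[OF residual_gain(1)[OF i[OF l]] \<tau>[OF l]] by (simp only: ac_simps)
      qed
      also have "\<dots> \<le> \<rho> * e" using G rho by simp
      finally have S: "(\<rho> - 1) * ?S \<le> \<rho> * e" .
      have "((\<rho> - 1) * (\<delta> k * ?d))\<^sup>2 = (\<rho> - 1)\<^sup>2 * (\<delta> k)\<^sup>2 * ?d\<^sup>2"
        by (simp add: power_mult_distrib)
      also have "\<dots> \<le> (\<rho> - 1)\<^sup>2 * (\<delta> k)\<^sup>2 * (?T * ?S)"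
        by (intro mult_left_mono Rs_diff_le N) auto
      \<comment> \<open>One factor \<open>\<rho> - 1\<close> goes to \<open>?T\<close>, the other to
        \<open>?S\<close>; the \<open>\<rho>\<close> in the bound of \<open>?S\<close> then
        completes the left side of \<open>rate\<close>.\<close>
      also have "\<dots> = ((\<rho> - 1) * (\<delta> k)\<^sup>2 * ?T) * ((\<rho> - 1) * ?S)"
        by (simp only: power2_eq_square ac_simps)
      also have "\<dots> \<le> ((\<rho> - 1) * (\<delta> k)\<^sup>2 * ?T) * (\<rho> * e)"
        using S rho t_mono[OF N(2)] by (intro mult_left_mono) auto
      also have "\<dots> = ((\<rho> - 1) * \<rho> * (\<delta> k)\<^sup>2 * ?T) * e" by (simp only: ac_simps)
      also have "\<dots> \<le> e * e" using rate e by (intro mult_right_mono) auto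
      finally show "((\<rho> - 1) * (\<delta> k * ?d))\<^sup>2 \<le> e\<^sup>2" by (simp only: power2_eq_square)
    qed (use e in simp)
    ultimately show ?case using N rate by blast
  qed
qed

section \<open>Limits at the stopping index\<close>

lemma delta_sq_lim: "(\<lambda>k. c * (\<delta> k)\<^sup>2) \<longlonglongrightarrow> 0"
  by (rule tendsto_mult_right_zero, rule tendsto_null_power[OF delta_lim]) simp

lemma D_stopped_tendsto_0:
  assumes w: "feasible g w" and small: "\<And>e. e > 0 \<Longrightarrow> \<exists>m. D (Suc m) g w < e"
  shows "(\<lambda>k. D (n k) (gs k) w) \<longlonglongrightarrow> 0"
proof (rule order_tendstoI)
  fix e :: real assume "e < 0"
  moreover have "0 \<le> D (n k) (gs k) w" for k
    using D_nonneg[of w "n k - 1" "gs k"] w stopping_index(1)[of k] by (simp add: feasible_def)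
  ultimately show "\<forall>\<^sub>F k in sequentially. e < D (n k) (gs k) w"
    by (intro always_eventually allI) (rule less_le_trans)
next
  fix e :: real assume e: "0 < e"
  then obtain m where "D (Suc m) g w < e/2" using small[of "e/2"] by auto
  note noisy_run_estimates[OF w this]
  moreover have "\<forall>\<^sub>F k in sequentially. b * \<rho> * (\<delta> k)\<^sup>2 < e/2"
    using e by (intro order_tendstoD(2)[OF delta_sq_lim]) simp
  ultimately show "\<forall>\<^sub>F k in sequentially. D (n k) (gs k) w < e"
  proof eventually_elim
    case (elim k)
    then show ?case by fastforce
  qed
qed

text \<open>The multiplier is \<open>Rs (Suc m) (gs k)\<close>, which converges in \<open>k\<close>,
  plus the increment up to \<open>N\<close>, plus one last step of norm at most
  \<open>b * \<rho> * \<delta> k\<close>. Multiplied by \<open>\<delta> k\<close>, each part becomes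
  small.\<close>

lemma dual_growth_tendsto_0:
  assumes w: "feasible g w" and small: "\<And>e. e > 0 \<Longrightarrow> \<exists>m. D (Suc m) g w < e"
  shows "(\<lambda>k. \<delta> k * norm (Rs (n k) (gs k))) \<longlonglongrightarrow> 0"
proof (rule LIMSEQ_I, simp only: diff_0_right flip: eventually_sequentially)
  fix e :: real assume e: "0 < e"
  \<comment> \<open>The factor \<open>\<rho> - 1\<close> cancels the one in the increment
    estimate.\<close>
  define e' where "e' = (\<rho> - 1) * (e/2)"
  have "e' > 0" using e rho by (simp add: e'_def)
  then obtain m where m: "D (Suc m) g w < e'" using small by blast
  have "(\<lambda>k. \<delta> k * norm (Rs (Suc m) (gs k)) + b * \<rho> * (\<delta> k)\<^sup>2)
      \<longlonglongrightarrow> 0 * norm (Rs (Suc m) g) + 0"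
    by (intro tendsto_intros Rs_tendsto gs_lim delta_lim delta_sq_lim)
  then have "\<forall>\<^sub>F k in sequentially. \<delta> k * norm (Rs (Suc m) (gs k)) + b * \<rho> * (\<delta> k)\<^sup>2 < e/2"
    using e by (intro order_tendstoD(2)) auto
  with noisy_run_estimates[OF w m]
  show "\<forall>\<^sub>F k in sequentially. norm (\<delta> k * norm (Rs (n k) (gs k))) < e"
  proof eventually_elim
    case (elim k)
    then obtain N where N: "n k = Suc N" "Suc m \<le> N"
      and d: "(\<rho> - 1) * (\<delta> k * norm (Rs N (gs k) - Rs (Suc m) (gs k))) \<le> e'" by blast
    let ?A = "Rs (Suc m) (gs k)" and ?B = "Rs N (gs k)" and ?r = "res (Suc N) (gs k)"
    have d': "\<delta> k * norm (?B - ?A) \<le> e/2" using d rho by (simp add: e'_def)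
    have "norm (\<tau> (Suc N) *\<^sub>R ?r) \<le> b * (\<rho> * \<delta> k)"
      using tau_pos[of "Suc N"] tau_le[of "Suc N"] stopping_index(2)[of k] N b_nonneg
      by (simp add: mult_mono)
    moreover have "norm (Rs (n k) (gs k)) \<le> norm ?A + norm (?B - ?A) + norm (\<tau> (Suc N) *\<^sub>R ?r)"
      using norm_triangle_ineq[of ?B "\<tau> (Suc N) *\<^sub>R ?r"] norm_triangle_sub[of ?B ?A]
      unfolding N(1) Rs_Suc[of N] by linarith
    ultimately have "norm (Rs (n k) (gs k)) \<le> norm ?A + norm (?B - ?A) + b * (\<rho> * \<delta> k)" by linarith
    then have "\<delta> k * norm (Rs (n k) (gs k)) \<le> \<delta> k * (norm ?A + norm (?B - ?A) + b * (\<rho> * \<delta> k))"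
      using delta_pos[of k] by (intro mult_left_mono) auto
    also have "\<dots> = \<delta> k * norm ?A + \<delta> k * norm (?B - ?A) + b * \<rho> * (\<delta> k)\<^sup>2"
      by (simp add: algebra_simps power2_eq_square)
    also have "\<dots> < e" using elim(2) d' by linarith
    finally show ?case using delta_pos[of k] by (simp add: abs_mult)
  qed
qed

lemma noise_rate:
  assumes w: "feasible g w" and small: "\<And>e. e > 0 \<Longrightarrow> \<exists>m. D (Suc m) g w < e"
  obtains C where "\<forall>\<^sub>F k in sequentially. (\<delta> k)\<^sup>2 * t (n k) \<le> C"
proof -
  obtain m where m: "D (Suc m) g w < 1" using small[of 1] by auto
  \<comment> \<open>The 1 absorbs the times \<open>t (Suc m)\<close> and
    \<open>\<tau> (Suc N)\<close> outside the estimate, since \<open>(\<delta> k)\<^sup>2\<close>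
    tends to 0.\<close>
  define C where "C = 1 / ((\<rho> - 1) * \<rho>) + 1"
  have "\<forall>\<^sub>F k in sequentially. (t (Suc m) + b) * (\<delta> k)\<^sup>2 < 1"
    by (intro order_tendstoD(2)[OF delta_sq_lim]) simp
  with noisy_run_estimates[OF w m] have "\<forall>\<^sub>F k in sequentially. (\<delta> k)\<^sup>2 * t (n k) \<le> C"
  proof eventually_elim
    case (elim k)
    then obtain N where N: "n k = Suc N" "Suc m \<le> N"
      and r: "(\<rho> - 1) * \<rho> * (\<delta> k)\<^sup>2 * (t N - t (Suc m)) \<le> 1" by blast
    have "(\<delta> k)\<^sup>2 * (t N - t (Suc m)) \<le> 1 / ((\<rho> - 1) * \<rho>)"
      using r rho by (subst pos_le_divide_eq) (simp_all add: ac_simps)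
    moreover have "(\<delta> k)\<^sup>2 * \<tau> (Suc N) \<le> (\<delta> k)\<^sup>2 * b"
      using tau_le[of "Suc N"] by (intro mult_left_mono) auto
    ultimately show ?case using elim(2) by (simp add: N C_def algebra_simps)
  qed
  then show thesis by (rule that)
qed

lemma K_stopped: "norm (K (R (n k) (gs k)) - g) \<le> (\<rho> + 1) * \<delta> k"
proof -
  have "K (R (n k) (gs k)) - g = (gs k - g) - res (n k) (gs k)" by (simp add: res_def)
  also have "norm \<dots> \<le> norm (gs k - g) + norm (res (n k) (gs k))" by (rule norm_triangle_ineq4)
  finally show ?thesis using noise[of k] stopping_index(2)[of k] by (simp add: algebra_simps)
qed

lemma K_stopped_tendsto: "(\<lambda>k. K (R (n k) (gs k))) \<longlonglongrightarrow> g"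
proof (rule LIM_zero_cancel, rule Lim_null_comparison)
  show "(\<lambda>k. (\<rho> + 1) * \<delta> k) \<longlonglongrightarrow> 0"
    by (intro tendsto_mult_right_zero delta_lim)
qed (simp add: K_stopped)

text \<open>Solve the definition of \<open>D\<close> for the value at the iterate. The pairing with
  the multiplier is at most
  \<open>(\<rho> + 1) * (\<delta> k * norm (Rs (n k) (gs k)))\<close>.\<close>

lemma j_stopped_tendsto:
  assumes w: "feasible g w" and small: "\<And>e. e > 0 \<Longrightarrow> \<exists>m. D (Suc m) g w < e"
  shows "(\<lambda>k. j (R (n k) (gs k))) \<longlonglongrightarrow> j w"
proof -
  let ?q = "\<lambda>k. Rs (n k) (gs k) \<bullet> (K w - K (R (n k) (gs k)))"
  have "?q \<longlonglongrightarrow> 0"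
  proof (rule Lim_null_comparison)
    show "\<forall>\<^sub>F k in sequentially. norm (?q k) \<le> (\<rho> + 1) * (\<delta> k * norm (Rs (n k) (gs k)))"
    proof (intro always_eventually allI)
      fix k
      have "norm (?q k) \<le> norm (Rs (n k) (gs k)) * norm (K w - K (R (n k) (gs k)))"
        using Cauchy_Schwarz_ineq2 by simp
      also have "\<dots> \<le> norm (Rs (n k) (gs k)) * ((\<rho> + 1) * \<delta> k)"
        using K_stopped[of k] w by (intro mult_left_mono) (auto simp: feasible_def norm_minus_commute)
      finally show "norm (?q k) \<le> (\<rho> + 1) * (\<delta> k * norm (Rs (n k) (gs k)))"
        by (simp only: ac_simps)
    qed
    show "(\<lambda>k. (\<rho> + 1) * (\<delta> k * norm (Rs (n k) (gs k)))) \<longlonglongrightarrow> 0"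
      by (intro tendsto_mult_right_zero dual_growth_tendsto_0[OF w small])
  qed
  then have "(\<lambda>k. j w - D (n k) (gs k) w - ?q k) \<longlonglongrightarrow> j w - 0 - 0"
    by (intro tendsto_intros D_stopped_tendsto_0[OF w small])
  then show ?thesis by (simp add: D_def)
qed

section \<open>Back to extended values, adjoints and cluster points\<close>

lemma J_stopped: "J (R (n k) (gs k)) < \<infinity>"
  using J_R[of "n k - 1" "gs k"] stopping_index(1)[of k] by simp

lemma bregman_distance_eq:
  assumes "J v < \<infinity>"
  shows "bregman_distance J (adjoint K (Rs (n k) (gs k))) v (R (n k) (gs k)) = ereal (D (n k) (gs k) v)"
  using adjoint_Hilbert[OF K, of "v - R (n k) (gs k)" "Rs (n k) (gs k)"]
  by (simp add: bregman_distance_def D_def J_eq[OF assms] J_eq[OF J_stopped]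
      bounded_linear.linear[OF K] linear_diff inner_commute)

lemma adjoint_in_subdifferential:
  "adjoint K (Rs (n k) (gs k)) \<in> subdifferential J (R (n k) (gs k))"
  unfolding subdifferential_def
proof (intro CollectI allI)
  fix v
  show "J (R (n k) (gs k)) + ereal (adjoint K (Rs (n k) (gs k)) \<bullet> (v - R (n k) (gs k))) \<le> J v"
  proof (cases "J v < \<infinity>")
    case True
    have "0 \<le> D (n k) (gs k) v"
      using D_nonneg[OF True, of "n k - 1" "gs k"] stopping_index(1)[of k] by simp
    then show ?thesis
      using adjoint_Hilbert[OF K, of "v - R (n k) (gs k)" "Rs (n k) (gs k)"]
      by (simp add: D_def J_eq[OF True] J_eq[OF J_stopped]
          bounded_linear.linear[OF K] linear_diff inner_commute)
  qed simp
qed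

lemma stopped_bounded:
  assumes "(\<lambda>k. j (R (n k) (gs k))) \<longlonglongrightarrow> c"
  shows "bounded (range (\<lambda>k. R (n k) (gs k)))"
proof -
  obtain A where A: "\<And>k. \<bar>j (R (n k) (gs k))\<bar> \<le> A"
    using convergent_imp_bounded[OF assms] by (auto simp: bounded_iff)
  obtain B where B: "\<And>k. norm (K (R (n k) (gs k))) \<le> B"
    using convergent_imp_bounded[OF K_stopped_tendsto] by (auto simp: bounded_iff)
  show ?thesis
  proof (rule bounded_of_sublevel[OF compactness, where c = "B\<^sup>2 + A"])
    fix k
    have "(norm (K (R (n k) (gs k))))\<^sup>2 \<le> B\<^sup>2" using B[of k] by (simp add: power_mono)
    moreover have "j (R (n k) (gs k)) \<le> A" using A[of k] by linarith
    ultimately show "ereal ((norm (K (R (n k) (gs k))))\<^sup>2) + J (R (n k) (gs k)) \<le> ereal (B\<^sup>2 + A)"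
      by (simp add: J_eq[OF J_stopped])
  qed
qed

lemma stopped_cluster_point:
  assumes "(\<lambda>k. j (R (n k) (gs k))) \<longlonglongrightarrow> c"
    and "weak_cluster_point (\<lambda>k. R (n k) (gs k)) l"
  shows "feasible g l" "j l \<le> c"
proof -
  let ?u = "\<lambda>k. R (n k) (gs k)"
  obtain r where r: "strict_mono r" and l: "weakly_converges (?u \<circ> r) l"
    using assms(2) by (auto simp: weak_cluster_point_def)
  have "K l = g"
    using weak_cluster_feasible[OF l] LIMSEQ_subseq_LIMSEQ[OF K_stopped_tendsto r] by (simp add: comp_def)
  have le: "J l < \<infinity> \<and> j l \<le> c + e" if "e > 0" for e
  proof -
    have "\<forall>\<^sub>F k in sequentially. j ((?u \<circ> r) k) < c + e"
      using LIMSEQ_subseq_LIMSEQ[OF assms(1) r] that by (intro order_tendstoD(2)) (auto simp: comp_def)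
    then have "\<forall>\<^sub>F k in sequentially. J ((?u \<circ> r) k) < \<infinity> \<and> j ((?u \<circ> r) k) \<le> c + e"
      by eventually_elim (use J_stopped in simp)
    from j_lsc[OF l this] show ?thesis by blast
  qed
  from le[of 1] show "feasible g l" using \<open>K l = g\<close> by (simp add: feasible_def)
  show "j l \<le> c" by (rule field_le_epsilon) (use le in blast)
qed

text \<open>The error in the image is at most \<open>(\<rho> + 1) * \<delta> k\<close>, and
  \<open>noise_rate\<close> bounds \<open>\<delta> k\<close> by a multiple of the inverse square
  root of the time.\<close>

lemma stopped_rate:
  assumes "feasible g w" "\<And>e. e > 0 \<Longrightarrow> \<exists>m. D (Suc m) g w < e"
  shows "(\<lambda>k. norm (K (R (n k) (gs k)) - g)) \<in> O(\<lambda>k. t (n k) powr (-1/2))"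
proof -
  obtain C where C: "\<forall>\<^sub>F k in sequentially. (\<delta> k)\<^sup>2 * t (n k) \<le> C"
    using noise_rate[OF assms] by blast
  show ?thesis
  proof (rule bigoI)
    show "\<forall>\<^sub>F k in sequentially. norm (norm (K (R (n k) (gs k)) - g))
        \<le> ((\<rho> + 1) * sqrt C) * norm (t (n k) powr (-1/2))"
      using C
    proof eventually_elim
      case (elim k)
      have t: "t (n k) > 0"
        using t_nonneg[of "n k - 1"] tau_pos[of "n k"] alm_time_Suc[of \<tau> "n k - 1"] stopping_index(1)[of k]
        by simp
      have "\<delta> k * sqrt (t (n k)) = sqrt ((\<delta> k)\<^sup>2 * t (n k))"
        using delta_pos[of k] by (simp add: real_sqrt_mult)
      also have "\<dots> \<le> sqrt C" using elim by simp
      finally have "\<delta> k \<le> sqrt C / sqrt (t (n k))" using t by (simp add: pos_le_divide_eq)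
      also have "\<dots> = sqrt C * t (n k) powr (-1/2)"
        using t by (simp add: powr_minus_divide powr_half_sqrt)
      finally have "(\<rho> + 1) * \<delta> k \<le> (\<rho> + 1) * (sqrt C * t (n k) powr (-1/2))"
        using rho by (intro mult_left_mono) auto
      then show ?case using K_stopped[of k] by (simp add: ac_simps)
    qed
  qed
qed

end



theorem corollary4p6:
  fixes K :: "'a::{real_inner, complete_space} \<Rightarrow> 'b::{real_inner, complete_space}"
    and J :: "'a \<Rightarrow> ereal"
    and g p0 :: 'b
    and \<tau> :: "nat \<Rightarrow> real"
    and R :: "nat \<Rightarrow> 'b \<Rightarrow> 'a"
    and Rs :: "nat \<Rightarrow> 'b \<Rightarrow> 'b"
    and \<rho> :: real
    and \<delta> :: "nat \<Rightarrow> real"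
    and gs :: "nat \<Rightarrow> 'b"
    and n :: "nat \<Rightarrow> nat"
    and u \<xi> :: "nat \<Rightarrow> 'a"
  assumes sep1: "separable_space (euclidean :: 'a topology)"
    and sep2: "separable_space (euclidean :: 'b topology)"
    and K: "bounded_linear K"
    and J_convex: "econvex J"
    and J_lsc: "lower_semicontinuous J"
    and J_proper: "proper J"
    and compactness: "weakly_compact_sublevels K J"
    and attainable: "\<exists>v \<in> effective_domain J. K v = g"
    and tau_pos: "\<And>k. 1 \<le> k \<Longrightarrow> \<tau> k > 0"
    and t_at_top: "filterlim (alm_time \<tau>) at_top sequentially"
    and tau_bdd: "bdd_above (\<tau> ` {1..})"
    and alm: "\<And>gd. alm_iteration K J \<tau> p0 gd (\<lambda>m. R m gd) (\<lambda>m. Rs m gd)"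
    and rho: "\<rho> > 1"
    and delta_pos: "\<And>k. \<delta> k > 0"
    and delta_lim: "\<delta> \<longlonglongrightarrow> 0"
    and noise: "\<And>k. norm (gs k - g) \<le> \<delta> k"
    and n_def: "\<And>k. n k = morozov K R \<rho> (\<delta> k) (gs k)"
    and n_lim: "filterlim n at_top sequentially"
    and u_def: "\<And>k. u k = R (n k) (gs k)"
    and xi_def: "\<And>k. \<xi> k = adjoint K (Rs (n k) (gs k))"
  shows "(\<forall>k. \<xi> k \<in> subdifferential J (u k)) \<and>
         bounded (range u) \<and>
         (\<forall>ud. weak_cluster_point u ud \<longrightarrow>
            J_minimizing_solution J K g ud \<and>
            (\<lambda>k. J (u k)) \<longlonglongrightarrow> J ud \<and>
            (\<lambda>k. bregman_distance J (\<xi> k) ud (u k)) \<longlonglongrightarrow> 0) \<and>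
         (\<lambda>k. norm (K (u k) - g)) \<in> O(\<lambda>k. alm_time \<tau> (n k) powr (-1/2))"
proof -
  obtain b where b: "\<And>k. 1 \<le> k \<Longrightarrow> \<tau> k \<le> b"
    using tau_bdd by (auto simp: bdd_above_def)
  interpret augmented_lagrangian K J \<tau> p0 R Rs
    using K J_convex J_lsc J_proper compactness tau_pos t_at_top alm
    by (rule augmented_lagrangian.intro)
  obtain v0 where v0: "feasible g v0"
    using attainable by (auto simp: feasible_def effective_domain_def)
  interpret morozov_stopping K J \<tau> p0 R Rs g \<rho> b \<delta> gs n
    using v0 b rho delta_pos delta_lim noise n_def n_lim by unfold_locales blast+
  obtain w where w: "feasible g w" and w_min: "\<And>v. feasible g v \<Longrightarrow> j w \<le> j v"
    and small: "\<And>e. e > 0 \<Longrightarrow> \<exists>m. D (Suc m) g w < e"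
    using exact_minimizer[OF v0] by blast
  have u: "u = (\<lambda>k. R (n k) (gs k))" using u_def by blast
  note lim = j_stopped_tendsto[OF w small]
  have "J_minimizing_solution J K g ud \<and> (\<lambda>k. J (u k)) \<longlonglongrightarrow> J ud \<and>
      (\<lambda>k. bregman_distance J (\<xi> k) ud (u k)) \<longlonglongrightarrow> 0"
    if "weak_cluster_point u ud" for ud
  proof -
    note ud = stopped_cluster_point[OF lim that[unfolded u]]
    \<comment> \<open>Lower semicontinuity gives one inequality, minimality of \<open>w\<close> the
      other.\<close>
    then have j_eq: "j ud = j w" using w_min[of ud] by simp
    have fin: "J ud < \<infinity>" using ud(1) by (simp add: feasible_def)
    have "\<not> J v < J ud" if "K v = g" for v
    proof
      assume less: "J v < J ud"
      then have "feasible g v" using that fin by (auto simp: feasible_def)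
      then show False using w_min[of v] less j_eq J_eq[OF fin] J_eq[of v] by (simp add: feasible_def)
    qed
    then have "J_minimizing_solution J K g ud"
      using ud(1) by (auto simp: J_minimizing_solution_def is_arg_min_def feasible_def)
    moreover have "(\<lambda>k. J (u k)) \<longlonglongrightarrow> J ud"
      using lim j_eq by (simp add: u J_eq[OF fin] J_eq[OF J_stopped])
    \<comment> \<open>\<open>D\<close> sees its last argument only through \<open>j\<close> and
      \<open>K\<close>, which agree on \<open>ud\<close> and \<open>w\<close>, so the limit proved
      for \<open>w\<close> carries over.\<close>
    moreover have "D m f ud = D m f w" for m f
      using j_eq ud(1) w by (simp add: D_def feasible_def)
    then have "(\<lambda>k. bregman_distance J (\<xi> k) ud (u k)) \<longlonglongrightarrow> 0"
      using D_stopped_tendsto_0[OF w small] by (simp add: u xi_def bregman_distance_eq[OF fin] zero_ereal_def)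
    ultimately show ?thesis by blast
  qed
  then show ?thesis
    using adjoint_in_subdifferential stopped_bounded[OF lim] stopped_rate[OF w small]
    by (simp add: u xi_def)
qed

end
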